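(* Let $P$ be a planar surface and let $K_1,K_3\in\mathrm{PC}(P)$ be compact with $K_1\subset K_3^\circ$. Then there is a closed rational rectangular union $K_2\in\mathrm{PC}(P)$ with $K_1\subset K_2^\circ$ and $K_2\subset K_3^\circ$. Moreover, if $K_3\in\overline{\mathrm{Disk}}(P)$, then $K_2$ can be chosen in $\overline{\mathrm{Disk}}(P)$.
   Context: A planar surface $P$ is a topological open disk with a basepoint $o_P$ and a developing map $\mathrm{dev}_P:P\to\mathbb R^2$, an orientation-preserving local homeomorphism with $\mathrm{dev}_P(o_P)=\mathbf 0$. $\mathrm{PC}(P)$ is the set of path-connected subsets of $P$ containing $o_P$; $\overline{\mathrm{Disk}}(P)$ is the set of elements of $\mathrm{PC}(P)$ homeomorphic to a closed $2$-disk and containing $o_P$ in their interior. $X^\circ$ denotes interior in $P$. A closed rectangle in the plane is a set $[a,b]\times[c,d]$ with $a<b$, $c<d$; it is rational if $a,b,c,d\in\mathbb Q$. A subset $R\subset P$ is a closed rectangle if $\mathrm{dev}_P(R)$ is a closed rectangle in the plane and $\mathrm{dev}_P|_R:R\to\mathrm{dev}_P(R)$ is a homeomorphism; it is rational if $\mathrm{dev}_P(R)$ is. A closed rectangular union in $P$ is a finite union of closed rectangles in $P$ which is connected and whose boundary is a disjoint collection of curves; it is rational if it can be written as a finite union of rational closed rectangles. *)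

theory Defs
  imports "HOL-Analysis.Analysis"
begin

text \<open>The plane is modelled as real \<times> real (Euclidean norm).
A planar surface is a topology X (its underlying space is P = topspace X),
a basepoint o and a developing map dev.\<close>

definition local_homeomorphism :: "'a topology \<Rightarrow> ('a \<Rightarrow> real \<times> real) \<Rightarrow> bool" where
  "local_homeomorphism X f \<longleftrightarrow>
     continuous_map X euclidean f \<and>
     (\<forall>x\<in>topspace X. \<exists>U. openin X U \<and> x \<in> U \<and> open (f ` U) \<and>
        homeomorphic_map (subtopology X U) (top_of_set (f ` U)) f)"

definition planar_surface :: "'a topology \<Rightarrow> 'a \<Rightarrow> ('a \<Rightarrow> real \<times> real) \<Rightarrow> bool" where
  "planar_surface X b dev \<longleftrightarrow>
     X homeomorphic_space top_of_set (ball (0::real \<times> real) 1) \<and>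
     b \<in> topspace X \<and> local_homeomorphism X dev \<and> dev b = 0"

definition PC :: "'a topology \<Rightarrow> 'a \<Rightarrow> 'a set set" where
  "PC X b = {S. S \<subseteq> topspace X \<and> path_connectedin X S \<and> b \<in> S}"

definition closed_Disk :: "'a topology \<Rightarrow> 'a \<Rightarrow> 'a set set" where
  "closed_Disk X b = {S. S \<in> PC X b \<and>
      subtopology X S homeomorphic_space top_of_set (cball (0::real \<times> real) 1) \<and>
      b \<in> X interior_of S}"

definition closed_rectangle_in :: "'a topology \<Rightarrow> ('a \<Rightarrow> real \<times> real) \<Rightarrow> 'a set \<Rightarrow> bool" where
  "closed_rectangle_in X dev R \<longleftrightarrow> R \<subseteq> topspace X \<and>
     (\<exists>a b c d. a < b \<and> c < d \<and> dev ` R = {a..b} \<times> {c..d}) \<and>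
     homeomorphic_map (subtopology X R) (top_of_set (dev ` R)) dev"

definition rational_closed_rectangle_in :: "'a topology \<Rightarrow> ('a \<Rightarrow> real \<times> real) \<Rightarrow> 'a set \<Rightarrow> bool" where
  "rational_closed_rectangle_in X dev R \<longleftrightarrow> closed_rectangle_in X dev R \<and>
     (\<exists>a b c d. a \<in> \<rat> \<and> b \<in> \<rat> \<and> c \<in> \<rat> \<and> d \<in> \<rat> \<and> dev ` R = {a..b} \<times> {c..d})"

definition closed_rect_union :: "'a topology \<Rightarrow> ('a \<Rightarrow> real \<times> real) \<Rightarrow> 'a set \<Rightarrow> bool" where
  "closed_rect_union X dev K \<longleftrightarrow>
     (\<exists>F. finite F \<and> (\<forall>R\<in>F. closed_rectangle_in X dev R) \<and> \<Union>F = K) \<and>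
     connectedin X K \<and>
     (\<exists>C. (\<forall>Y\<in>C. subtopology X Y homeomorphic_space top_of_set (sphere (0::real \<times> real) 1)) \<and>
          pairwise disjnt C \<and> \<Union>C = X frontier_of K)"

definition rational_closed_rect_union :: "'a topology \<Rightarrow> ('a \<Rightarrow> real \<times> real) \<Rightarrow> 'a set \<Rightarrow> bool" where
  "rational_closed_rect_union X dev K \<longleftrightarrow> closed_rect_union X dev K \<and>
     (\<exists>F. finite F \<and> (\<forall>R\<in>F. rational_closed_rectangle_in X dev R) \<and> \<Union>F = K)"

end

theory Submission
  imports Defs
begin

text \<open>Identify the surface with the complex plane, so that the developing map becomes a local
  homeomorphism into the plane.  Tile the plane by bricks whose rows are shifted by half a brick, so
  that only three bricks meet at a vertex and two touching bricks share an edge.  After scaling by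
  \<open>1/n\<close> all bricks near \<open>K3\<close> lift, and the lifts tile a neighbourhood of \<open>K3\<close> by disks.  In the
  general case \<open>K2\<close> is the union of the tiles meeting \<open>K1\<close>; if \<open>K3\<close> is a disk, the holes of this union
  are filled in, and they stay inside \<open>K3\<close> because the complement of \<open>K3\<close> is connected and unbounded.

  The key point is that a connected union of tiles with connected complement is a closed disk: some
  boundary tile can be removed without disconnecting the union, by unicoherence it meets the rest
  in an arc, and gluing two disks along a boundary arc gives a disk.  In particular the frontier of
  every complementary component of \<open>K2\<close> is a circle, since after filling or taking closures it is the
  frontier of such a disk; different components have disjoint closures because tiles meet along edges.\<close>

section \<open>Arcs in the boundary circle of the disk\<close>

text \<open>A union of squares may touch itself at a corner, where its boundary fails to be a
  disjoint collection of curves; this is what bricks avoid. The developing map need not be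
  injective, so distinct tiles may lie over the same brick, and only the way touching tiles meet can
  be read off in the plane. The topology of their unions is therefore derived from abstract
  conditions on a finite family of disks. The tiled region is a whole round disk around
  \<open>K3\<close>, because a hole of \<open>K2\<close> may contain points outside
  \<open>K3\<close> and must still be covered by tiles before its boundary is seen to be a circle.
  No Jordan curve is given in advance: disks are recognised by induction on the number of tiles, and
  the circles come out as boundaries of disks.\<close>

lemma common_quotient_homeomorphism:
  fixes p :: "'a::topological_space \<Rightarrow> 'b::t2_space" and q :: "'a \<Rightarrow> 'c::t2_space"
  assumes "compact S" and p: "continuous_on S p" and q: "continuous_on S q"
    and pq: "\<And>x y. x \<in> S \<Longrightarrow> y \<in> S \<Longrightarrow> p x = p y \<longleftrightarrow> q x = q y"
  obtains f g where "homeomorphism (p ` S) (q ` S) f g" "\<And>x. x \<in> S \<Longrightarrow> f (p x) = q x"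
proof -
  define f where "f y = q (SOME x. x \<in> S \<and> p x = y)" for y
  have fp: "f (p x) = q x" if "x \<in> S" for x
  proof -
    have "(SOME x'. x' \<in> S \<and> p x' = p x) \<in> S \<and> p (SOME x'. x' \<in> S \<and> p x' = p x) = p x"
      by (rule someI[where x = x]) (use that in auto)
    then show ?thesis
      unfolding f_def using pq that by auto
  qed
  have "continuous_on (p ` S) f"
    unfolding continuous_on_closed_invariant
  proof (intro allI impI)
    fix B :: "'c set" assume "closed B"
    then obtain A where A: "closed A" "A \<inter> S = q -` B \<inter> S"
      using q unfolding continuous_on_closed_invariant by blast
    \<comment> \<open>The preimage of \<open>B\<close> under \<open>f\<close> is the
      \<open>p\<close>-image of a closed part of \<open>S\<close>; compactness makes this image
      closed although \<open>p\<close> may be far from injective.\<close>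
    have "compact (p ` (S \<inter> A))"
      using A(1) \<open>compact S\<close> p by (meson compact_Int_closed compact_continuous_image continuous_on_subset inf_le1)
    moreover have "p ` (S \<inter> A) \<inter> p ` S = f -` B \<inter> p ` S"
    proof -
      have "S \<inter> A = {x \<in> S. q x \<in> B}" using A(2) by auto
      then show ?thesis using fp by auto
    qed
    ultimately show "\<exists>A. closed A \<and> A \<inter> p ` S = f -` B \<inter> p ` S"
      using compact_imp_closed by blast
  qed
  moreover have "f ` p ` S = q ` S"
    using fp by (auto simp: image_iff)
  moreover have "inj_on f (p ` S)"
    by (auto simp: inj_on_def fp pq)
  moreover have "compact (p ` S)"
    using \<open>compact S\<close> p by (rule compact_continuous_image[rotated])
  ultimately obtain g where "homeomorphism (p ` S) (q ` S) f g"
    using homeomorphism_compact by metis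
  with fp that show ?thesis by blast
qed

text \<open>Invariance of domain, applied to \<open>f\<close> and to its inverse, makes the interior
  independent of the embedding.\<close>

lemma homeomorphism_image_interior:
  fixes S :: "'a::euclidean_space set" and T :: "'b::euclidean_space set"
  assumes "homeomorphism S T f g" "DIM('a) = DIM('b)"
  shows "f ` interior S = interior T"
proof
  have inj: "inj_on f S" "inj_on g T"
    using assms(1) by (metis homeomorphism_apply1 inj_on_inverseI)
      (metis assms(1) homeomorphism_apply2 inj_on_inverseI)
  have "f \<in> interior S \<rightarrow> interior (f ` S)"
    by (rule continuous_image_subset_interior)
       (use assms inj homeomorphism_cont1 in auto)
  then show "f ` interior S \<subseteq> interior T"
    using assms(1) homeomorphism_image1 by fastforce
  have "g \<in> interior T \<rightarrow> interior (g ` T)"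
    by (rule continuous_image_subset_interior)
       (use assms inj homeomorphism_cont2 in auto)
  then have *: "g ` interior T \<subseteq> interior S"
    using assms(1) homeomorphism_image2 by fastforce
  show "interior T \<subseteq> f ` interior S"
  proof
    fix y assume "y \<in> interior T"
    then have "f (g y) = y" "g y \<in> interior S"
      using * homeomorphism_apply2[OF assms(1)] interior_subset by auto
    then show "y \<in> f ` interior S" by (metis imageI)
  qed
qed

lemma homeomorphism_image_frontier:
  fixes S :: "'a::euclidean_space set" and T :: "'b::euclidean_space set"
  assumes hom: "homeomorphism S T f g" and "DIM('a) = DIM('b)" "closed S" "closed T"
  shows "f ` frontier S = frontier T"
proof -
  have inj: "inj_on f S"
    by (metis hom homeomorphism_apply1 inj_on_inverseI)
  have "f ` (S - interior S) = f ` S - f ` interior S"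
    using inj interior_subset by (metis Diff_subset inj_on_image_set_diff)
  then show ?thesis
    using homeomorphism_image_interior[OF assms(1,2)] homeomorphism_image1[OF hom] assms(3,4)
    by (simp add: frontier_def)
qed

lemma cis_eq_iff_period:
  assumes "x \<in> {0..2*pi}" "y \<in> {0..2*pi}"
  shows "cis x = cis y \<longleftrightarrow> x = y \<or> {x, y} = {0, 2*pi}"
proof
  assume "cis x = cis y"
  then have "sin x = sin y \<and> cos x = cos y"
    by (simp add: complex_eq_iff)
  then obtain n :: int where n: "x = y + 2 * pi * n"
    using sin_cos_eq_iff by blast
  have "2 * pi * n \<le> 2 * pi * 1" "2 * pi * (-1) \<le> 2 * pi * n"
    using assms n unfolding atLeastAtMost_iff by linarith+
  then have "real_of_int n \<le> 1" "-1 \<le> real_of_int n"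
    using mult_le_cancel_left_pos[of "2*pi"] by (metis mult_pos_pos pi_gt_zero zero_less_numeral)+
  then consider "n = 0" | "n = 1" | "n = -1" by linarith
  then show "x = y \<or> {x, y} = {0, 2*pi}"
    using n assms by cases (auto simp: )
next
  assume "x = y \<or> {x, y} = {0, 2*pi}"
  then show "cis x = cis y" by (auto simp: doubleton_eq_iff)
qed

lemma cball_eq_polar: "(\<lambda>(r, x). complex_of_real r * cis x) ` ({0..1} \<times> {0..2*pi}) = cball 0 1"
proof -
  have "z \<in> (\<lambda>(r, x). complex_of_real r * cis x) ` ({0..1} \<times> {0..2*pi})" if "norm z \<le> 1" for z
  proof -
    have "z = complex_of_real (norm z) * cis (Arg2pi z)"
      using Arg2pi_eq[of z] by (simp add: cis_conv_exp)
    then show ?thesis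
      using that Arg2pi_ge_0[of z] Arg2pi_lt_2pi[of z] 
      by (intro image_eqI[where x = "(norm z, Arg2pi z)"]) auto
  qed
  then show ?thesis by (auto simp: norm_mult)
qed

text \<open>Cutting the circle at a point \<open>u\<close> outside \<open>\<gamma>\<close> makes the
  angle relative to \<open>u\<close> continuous on \<open>\<gamma>\<close>, so
  \<open>\<gamma>\<close> corresponds to a compact interval of angles.\<close>

lemma circle_arc_param:
  fixes \<gamma> :: "complex set"
  assumes "closed \<gamma>" "connected \<gamma>" "\<gamma> \<subseteq> sphere 0 1" "\<gamma> \<noteq> sphere 0 1" and nt: "\<not> (\<exists>x. \<gamma> \<subseteq> {x})"
  obtains v w where "norm v = 1" "0 < w" "w < 2 * pi" "\<gamma> = (\<lambda>x. v * cis x) ` {0..w}"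
proof -
  obtain u where u: "norm u = 1" "u \<notin> \<gamma>"
  proof -
    have "\<not> sphere 0 1 \<subseteq> \<gamma>" using assms(3,4) by blast
    then obtain u where "u \<in> sphere 0 1" "u \<notin> \<gamma>" by blast
    then show ?thesis using that[of u] by simp
  qed
  then have "u \<noteq> 0" by auto
  define h where "h z = Arg2pi (z / u)" for z
  have zu: "norm (z / u) = 1" if "z \<in> \<gamma>" for z
    using that assms(3) u by (auto simp: norm_divide)
  have zu': "z / u \<notin> \<real>\<^sub>\<ge>\<^sub>0" if "z \<in> \<gamma>" for z
  proof
    assume "z / u \<in> \<real>\<^sub>\<ge>\<^sub>0"
    then obtain r where "z / u = of_real r" "r \<ge> 0"
      using nonneg_Reals_cases by blast
    moreover have "r = 1" using zu[OF that] calculation by auto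
    ultimately show False using u that \<open>u \<noteq> 0\<close> by auto
  qed
  have z: "z = u * cis (h z)" if "z \<in> \<gamma>" for z
    using Arg2pi_eq[of "z / u"] zu[OF that] \<open>u \<noteq> 0\<close> by (auto simp: h_def cis_conv_exp field_simps)
  have "continuous_on \<gamma> h"
    unfolding continuous_on_eq_continuous_within
  proof
    fix z assume "z \<in> \<gamma>"
    then have "isCont Arg2pi (z / u)"
      using zu' continuous_at_Arg2pi by blast
    moreover have "isCont (\<lambda>z. z / u) z"
      using \<open>u \<noteq> 0\<close> by (intro continuous_intros) auto
    ultimately have "isCont h z"
      unfolding h_def using isCont_o2 by blast
    then show "continuous (at z within \<gamma>) h"
      by (simp add: continuous_at_imp_continuous_at_within)
  qed
  moreover have "compact \<gamma>"
    using assms(1,3) by (meson bounded_sphere bounded_subset compact_eq_bounded_closed)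
  ultimately have "connected (h ` \<gamma>) \<and> compact (h ` \<gamma>)"
    using assms(2) compact_continuous_image connected_continuous_image by blast
  then obtain s t where st: "h ` \<gamma> = {s..t}"
    unfolding connected_compact_interval_1 by blast
  have \<gamma>: "\<gamma> = (\<lambda>x. u * cis x) ` {s..t}"
  proof -
    have "x \<in> (\<lambda>x. u * cis x) ` {s..t}" if "x \<in> \<gamma>" for x
      unfolding st[symmetric] using z[OF that] that by (rule image_eqI[OF _ imageI])
    moreover have "u * cis y \<in> \<gamma>" if "y \<in> {s..t}" for y
    proof -
      have "y \<in> h ` \<gamma>" unfolding st by (fact that)
      then obtain x where x: "x \<in> \<gamma>" "y = h x" by (elim imageE) auto
      have "u * cis y = x" unfolding x(2) by (rule z[OF x(1), symmetric])
      then show ?thesis using x(1) by (rule ssubst)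
    qed
    ultimately show ?thesis by blast
  qed
  have "s < t"
  proof (rule ccontr)
    assume "\<not> s < t"
    then have "{s..t} \<subseteq> {s}" by auto
    then show False using nt \<gamma> by blast
  qed
  have "s \<in> h ` \<gamma>" "t \<in> h ` \<gamma>" using st \<open>s < t\<close> by auto
  then have "0 \<le> s" "t < 2 * pi"
    using Arg2pi_ge_0 Arg2pi_lt_2pi unfolding h_def by auto
  show ?thesis
  proof
    show "norm (u * cis s) = 1" using u by (simp add: norm_mult)
    show "0 < t - s" "t - s < 2 * pi" using \<open>s < t\<close> \<open>0 \<le> s\<close> \<open>t < 2*pi\<close> by auto
    have "(\<lambda>x. u * cis s * cis x) ` {0..t - s} = (\<lambda>x. u * cis x) ` (\<lambda>x. s + x) ` {0..t - s}"
      unfolding image_image by (simp add: mult.assoc cis_mult)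
    also have "(\<lambda>x. s + x) ` {0..t - s} = {s..t}" by simp
    finally show "\<gamma> = (\<lambda>x. u * cis s * cis x) ` {0..t - s}"
      using \<gamma> by (metis (no_types))
  qed
qed

text \<open>A change of angle that keeps the radius extends from the circle to the disk; here it
  stretches or squeezes the given arc to a half-turn.\<close>

lemma cball_homeomorphism_straightening_arc:
  fixes \<gamma> :: "complex set"
  assumes "closed \<gamma>" "connected \<gamma>" "\<gamma> \<subseteq> sphere 0 1" "\<gamma> \<noteq> sphere 0 1" "\<not> (\<exists>x. \<gamma> \<subseteq> {x})"
  obtains f g where "homeomorphism (cball 0 1) (cball (0::complex) 1) f g" "f ` \<gamma> = cis ` {0..pi}"
proof -
  obtain v w where v: "norm v = 1" and w: "0 < w" "w < 2 * pi" and \<gamma>: "\<gamma> = (\<lambda>x. v * cis x) ` {0..w}"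
    using circle_arc_param[OF assms] .
  \<comment> \<open>Piecewise linear and increasing with a bend at \<open>w\<close>: it takes
    \<open>{0..w}\<close> onto \<open>{0..pi}\<close> and \<open>{w..2*pi}\<close> onto
    \<open>{pi..2*pi}\<close>.\<close>
  define th where "th x = (pi / w) * min x w + (pi / (2*pi - w)) * max 0 (x - w)" for x
  have c: "0 < pi / w" "0 < pi / (2*pi - w)" using w by auto
  have mono: "th x < th y" if "x < y" for x y
  proof (cases "x < w")
    case True
    then have "min x w < min y w" using that by auto
    then have "(pi / w) * min x w < (pi / w) * min y w" using c(1) by (rule mult_strict_left_mono)
    moreover have "(pi / (2*pi - w)) * max 0 (x - w) \<le> (pi / (2*pi - w)) * max 0 (y - w)"
      using that c by (intro mult_left_mono) auto
    ultimately show ?thesis by (simp add: th_def)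
  next
    case False
    then have "max 0 (x - w) < max 0 (y - w)" using that by auto
    then have "(pi / (2*pi - w)) * max 0 (x - w) < (pi / (2*pi - w)) * max 0 (y - w)"
      using c by (intro mult_strict_left_mono) auto
    then show ?thesis using False that by (simp add: th_def)
  qed
  have [simp]: "th 0 = 0" "th w = pi" using w by (auto simp: th_def)
  have [simp]: "th (2*pi) = 2*pi" using w by (auto simp: th_def field_simps)
  have cont: "continuous_on T th" for T
    unfolding th_def by (intro continuous_intros)
  have mono': "th x \<le> th y \<longleftrightarrow> x \<le> y" for x y
    using mono[of x y] mono[of y x] by (cases x y rule: linorder_cases) auto
  have inj: "th x = th y \<longleftrightarrow> x = y" for x y
    using mono[of x y] mono[of y x] by (cases x y rule: linorder_cases) auto
  have onto: "th ` {a..b} = {th a..th b}" if ab: "a \<le> b" for a b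
  proof
    show "th ` {a..b} \<subseteq> {th a..th b}" using mono' by auto
    show "{th a..th b} \<subseteq> th ` {a..b}"
    proof
      fix y assume "y \<in> {th a..th b}"
      then obtain x where "a \<le> x" "x \<le> b" "th x = y"
        using IVT'[of th a y b, OF _ _ ab cont] by auto
      then show "y \<in> th ` {a..b}" by auto
    qed
  qed
  let ?S = "{0..1::real} \<times> {0..2*pi}"
  define p where "p = (\<lambda>(r, x). complex_of_real r * (v * cis x))"
  define q where "q = (\<lambda>(r, x). complex_of_real r * cis (th x))"
  have v0: "v \<noteq> 0" using v by auto
  \<comment> \<open>Polar coordinates have the same fibres before and after the change of angle:
    radius 0 collapses, and the angles 0 and \<open>2*pi\<close> agree. Passing to quotients
    replaces a continuity argument at the centre and along the cut.\<close>
  obtain f g where hom: "homeomorphism (p ` ?S) (q ` ?S) f g" and f: "\<And>x. x \<in> ?S \<Longrightarrow> f (p x) = q x"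
  proof (rule common_quotient_homeomorphism[of ?S p q])
    show "compact ?S" by (intro compact_Times) auto
    show "continuous_on ?S p"
      unfolding p_def case_prod_unfold by (intro continuous_intros continuous_on_cis)
    show "continuous_on ?S q"
      unfolding q_def case_prod_unfold 
      by (intro continuous_intros continuous_on_cis continuous_on_compose2[OF cont[of UNIV]]) auto
    fix a b assume "a \<in> ?S" "b \<in> ?S"
    then obtain r x s y where ab: "a = (r, x)" "b = (s, y)" and r: "0 \<le> r" "0 \<le> s" 
      and x: "x \<in> {0..2*pi}" "y \<in> {0..2*pi}"
      by (cases a, cases b) auto
    have th: "th x \<in> {0..2*pi}" "th y \<in> {0..2*pi}"
      using x mono'[of 0] mono'[of _ "2*pi"] by auto
    have "{th x, th y} = {0, 2*pi} \<longleftrightarrow> {x, y} = {0, 2*pi}"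
      using inj[of _ 0] inj[of _ "2*pi"] by (auto simp: doubleton_eq_iff)
    then have cis: "cis (th x) = cis (th y) \<longleftrightarrow> cis x = cis y"
      using cis_eq_iff_period[OF x] cis_eq_iff_period[OF th] inj by auto
    have "p a = p b \<longleftrightarrow> r = s \<and> (r = 0 \<or> cis x = cis y)"
    proof
      assume *: "p a = p b"
      then have "norm (p a) = norm (p b)" by simp
      then have "r = s" using r v by (simp add: p_def ab norm_mult)
      then show "r = s \<and> (r = 0 \<or> cis x = cis y)" using * v0 by (simp add: p_def ab)
    qed (auto simp: p_def ab)
    moreover have "q a = q b \<longleftrightarrow> r = s \<and> (r = 0 \<or> cis x = cis y)"
    proof
      assume *: "q a = q b"
      then have "norm (q a) = norm (q b)" by simp
      then have "r = s" using r v by (simp add: q_def ab norm_mult)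
      then show "r = s \<and> (r = 0 \<or> cis x = cis y)" using * cis by (simp add: q_def ab)
    qed (auto simp: q_def ab cis)
    ultimately show "p a = p b \<longleftrightarrow> q a = q b" by simp
  qed blast
  have "q ` ?S = (\<lambda>(r, x). complex_of_real r * cis x) ` map_prod id th ` ?S"
    by (auto simp: q_def image_image case_prod_unfold)
  also have "map_prod id th ` ?S = ?S"
    using onto[of 0 "2*pi"] by (simp add: map_prod_surj_on)
  finally have 1: "q ` ?S = cball 0 1" using cball_eq_polar by simp
  have "p ` ?S = (*) v ` (\<lambda>(r, x). complex_of_real r * cis x) ` ?S"
    unfolding image_image by (rule image_cong) (auto simp: p_def algebra_simps)
  also have "\<dots> = (*) v ` cball 0 1" using cball_eq_polar by simp
  also have "\<dots> = cball 0 1"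
  proof
    show "cball 0 1 \<subseteq> (*) v ` cball 0 1"
    proof
      fix z :: complex assume "z \<in> cball 0 1"
      then have "z / v \<in> cball 0 1" "z = v * (z / v)" using v v0 by (auto simp: norm_divide)
      then show "z \<in> (*) v ` cball 0 1" by blast
    qed
  qed (use v in \<open>auto simp: norm_mult\<close>)
  finally have 2: "p ` ?S = cball 0 1" .
  have "f ` \<gamma> = cis ` th ` {0..w}"
    unfolding \<gamma> image_image
  proof (rule image_cong)
    fix x assume "x \<in> {0..w}"
    then show "f (v * cis x) = cis (th x)"
      using f[of "(1, x)"] w by (auto simp: p_def q_def)
  qed simp
  then have "f ` \<gamma> = cis ` {0..pi}"
    using onto[of 0 w] w by simp
  with hom 1 2 that show ?thesis by simp
qed

section \<open>Gluing closed disks along boundary arcs\<close>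

definition closed_disk :: "complex set \<Rightarrow> bool" where
  "closed_disk S \<longleftrightarrow> S homeomorphic cball (0::complex) 1"

lemma closed_disk_homeomorphism:
  assumes "closed_disk A"
  obtains f g where "homeomorphism A (cball (0::complex) 1) f g"
    "f ` interior A = ball 0 1" "f ` frontier A = sphere 0 1"
proof -
  obtain f g where fg: "homeomorphism A (cball (0::complex) 1) f g"
    using assms unfolding closed_disk_def homeomorphic_def by blast
  have "compact A"
    using assms compact_cball homeomorphic_compactness unfolding closed_disk_def by blast
  then have "f ` frontier A = sphere 0 1"
    using homeomorphism_image_frontier[OF fg] by (simp add: compact_imp_closed)
  moreover have "f ` interior A = ball 0 1"
    using homeomorphism_image_interior[OF fg] by simp
  ultimately show ?thesis using fg that by blast
qed

lemma closed_disk_compact: "closed_disk A \<Longrightarrow> compact A"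
  using compact_cball homeomorphic_compactness unfolding closed_disk_def by blast

lemma closed_disk_connected: "closed_disk A \<Longrightarrow> connected A"
  using homeomorphic_connectedness[of A "cball (0::complex) 1"] unfolding closed_disk_def by simp

lemma closed_disk_path_connected: "closed_disk A \<Longrightarrow> path_connected A"
  using homeomorphic_path_connectedness[of A "cball (0::complex) 1"] convex_imp_path_connected[of "cball (0::complex) 1"]
  unfolding closed_disk_def by simp

lemma closed_disk_interior:
  assumes "closed_disk A"
  shows "connected (interior A)" "interior A \<noteq> {}" "A \<subseteq> closure (interior A)"
proof -
  obtain f g where fg: "homeomorphism A (cball (0::complex) 1) f g" "f ` interior A = ball 0 1"
    using closed_disk_homeomorphism[OF assms] by metis
  have g: "g ` ball 0 1 = interior A"
    using fg(2) homeomorphism_apply1[OF fg(1)] interior_subset by (force simp flip: fg(2) simp: image_image)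
  have cont: "continuous_on (cball 0 1) g"
    using fg(1) homeomorphism_cont2 by blast
  show "connected (interior A)"
    unfolding g[symmetric]
    by (rule connected_continuous_image[OF continuous_on_subset[OF cont ball_subset_cball]]) simp
  show "interior A \<noteq> {}" using fg(2) by (metis ball_eq_empty image_empty not_one_le_zero)
  have "g ` closure (ball 0 1) \<subseteq> closure (g ` ball 0 1)"
    using cont by (intro image_closure_subset closure_subset) auto
  then show "A \<subseteq> closure (interior A)"
    using homeomorphism_image2[OF fg(1)] g by simp
qed

lemma closed_disk_frontier:
  assumes "closed_disk A"
  shows "frontier A homeomorphic sphere (0::complex) 1" "connected (frontier A)"
proof -
  show *: "frontier A homeomorphic sphere (0::complex) 1"
    using homeomorphic_frontiers_same_dimension[of A "cball (0::complex) 1"] assms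
      closed_disk_compact[OF assms] unfolding closed_disk_def by (simp add: compact_imp_closed)
  show "connected (frontier A)"
    using homeomorphic_connectedness[OF *] by (simp add: connected_sphere)
qed

lemma closed_disk_convex:
  assumes "compact A" "convex A" "interior A \<noteq> {}"
  shows "closed_disk A"
  unfolding closed_disk_def using assms by (intro homeomorphic_convex_compact) auto

text \<open>The hypotheses on \<open>\<gamma>\<close> single out the nondegenerate proper arcs of
  the boundary circle. They pass to the image in the round disk, where the change of angle
  applies.\<close>

lemma disk_arc_normal_form:
  assumes A: "closed_disk A" and \<gamma>: "closed \<gamma>" "connected \<gamma>" "\<gamma> \<subseteq> frontier A" "\<gamma> \<noteq> frontier A"
    "\<not> (\<exists>x. \<gamma> \<subseteq> {x})"
  obtains f g where "homeomorphism A (cball (0::complex) 1) f g" "f ` \<gamma> = cis ` {0..pi}"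
proof -
  obtain f g where fg: "homeomorphism A (cball (0::complex) 1) f g" and fr: "f ` frontier A = sphere 0 1"
    using closed_disk_homeomorphism[OF A] by metis
  have sub: "frontier A \<subseteq> A"
    using closed_disk_compact[OF A] by (simp add: compact_imp_closed frontier_subset_closed)
  have inj: "inj_on f A"
    by (metis fg homeomorphism_apply1 inj_on_inverseI)
  have cont: "continuous_on \<gamma> f"
    using homeomorphism_cont1[OF fg] continuous_on_subset \<gamma>(3) sub by blast
  have "compact \<gamma>"
    by (metis A \<gamma>(1,3) closed_disk_compact compact_Int_closed inf.absorb2 order_trans sub)
  then have 1: "closed (f ` \<gamma>)" "connected (f ` \<gamma>)"
    using cont \<gamma>(2) compact_continuous_image compact_imp_closed connected_continuous_image by blast+
  have 2: "f ` \<gamma> \<subseteq> sphere 0 1" using fr \<gamma>(3) by blast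
  have 3: "f ` \<gamma> \<noteq> sphere 0 1"
    using fr \<gamma>(3,4) sub inj by (metis inj_on_image_eq_iff order_trans)
  have 4: "\<not> (\<exists>x. f ` \<gamma> \<subseteq> {x})"
  proof
    assume "\<exists>x. f ` \<gamma> \<subseteq> {x}"
    then obtain x where "f ` \<gamma> \<subseteq> {x}" by blast
    then have "g ` f ` \<gamma> \<subseteq> {g x}" by auto
    moreover have "g ` f ` \<gamma> = \<gamma>"
      using homeomorphism_apply1[OF fg] \<gamma>(3) sub by (force simp: image_image)
    ultimately show False using \<gamma>(5) by auto
  qed
  obtain h k where hk: "homeomorphism (cball 0 1) (cball 0 1) h k" "h ` f ` \<gamma> = cis ` {0..pi}"
    using cball_homeomorphism_straightening_arc[OF 1 2 3 4] by metis
  show ?thesis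
    using that[OF homeomorphism_compose[OF fg hk(1)]] hk(2) by (simp add: image_comp)
qed

text \<open>A box and its mirror image in the base make up a larger box; this is the model in which
  two disks are glued.\<close>

abbreviation upper_box :: "complex set" where
  "upper_box \<equiv> cbox (Complex (-1) 0) (Complex 1 1)"

abbreviation box_base :: "complex set" where
  "box_base \<equiv> (\<lambda>x. Complex x 0) ` {-1..1}"

lemma in_cbox_Complex: "z \<in> cbox (Complex a b) (Complex c d) \<longleftrightarrow> Re z \<in> {a..c} \<and> Im z \<in> {b..d}"
  by (auto simp: in_cbox_complex_iff)

lemma interior_cbox_Complex:
  assumes "a < c" "b < d"
  shows "interior (cbox (Complex a b) (Complex c d)) \<noteq> {}"
proof -
  have "Complex ((a+c)/2) ((b+d)/2) \<in> box (Complex a b) (Complex c d)"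
    using assms by (auto simp: in_box_complex_iff)
  then show ?thesis by auto
qed

text \<open>Both pairs, \<open>A\<close> with \<open>\<gamma>\<close> and the box with its base,
  have the same half-circle normal form, so one is carried to the other through the round
  disk.\<close>

lemma disk_arc_box_form:
  assumes A: "closed_disk A" and \<gamma>: "closed \<gamma>" "connected \<gamma>" "\<gamma> \<subseteq> frontier A" "\<gamma> \<noteq> frontier A"
    "\<not> (\<exists>x. \<gamma> \<subseteq> {x})"
  obtains f g where "homeomorphism A upper_box f g" "f ` \<gamma> = box_base"
proof -
  have Q: "closed_disk upper_box"
    by (rule closed_disk_convex) (use interior_cbox_Complex[of "-1" 1 0 1] in auto)
  have cl: "closed_segment (Complex (-1) 0) (Complex 1 0) = box_base"
    by (rule closed_segment_same_Im[THEN trans]) (auto simp: closed_segment_eq_real_ivl complex_eq_iff image_iff)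
  obtain h k where hk: "homeomorphism upper_box (cball 0 1) h k" "h ` box_base = cis ` {0..pi}"
  proof (rule disk_arc_normal_form[OF Q])
    show "closed box_base" "connected box_base"
      unfolding cl[symmetric] by auto
    show "box_base \<subseteq> frontier upper_box"
      by (auto simp: frontier_cbox in_cbox_complex_iff in_box_complex_iff)
    have "Complex 0 1 \<in> frontier upper_box - box_base"
      by (auto simp: frontier_cbox in_cbox_complex_iff in_box_complex_iff)
    then show "box_base \<noteq> frontier upper_box" by blast
    have "Complex 0 0 \<in> box_base" "Complex 1 0 \<in> box_base" by auto
    then show "\<not> (\<exists>x. box_base \<subseteq> {x})" by (metis complex.inject one_neq_zero singletonD subsetD)
  qed blast
  obtain f g where fg: "homeomorphism A (cball (0::complex) 1) f g" "f ` \<gamma> = cis ` {0..pi}"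
    using disk_arc_normal_form[OF A \<gamma>] .
  have "k ` h ` box_base = box_base"
  proof -
    have "k (h z) = z" if "z \<in> box_base" for z
      by (rule homeomorphism_apply1[OF hk(1)]) (use that in \<open>auto simp: in_cbox_Complex\<close>)
    then show ?thesis by (simp add: image_image)
  qed
  then show ?thesis
    using that[OF homeomorphism_compose[OF fg(1) homeomorphism_symD[OF hk(1)]]] fg(2) hk(2)
    by (metis image_comp)
qed

text \<open>\<open>A\<close> goes to the upper box and \<open>B\<close> to its mirror image. The two
  charts may parametrise the common arc differently, so the horizontal coordinate in the chart of
  \<open>B\<close> has to be corrected first.\<close>

lemma closed_disk_Un_along_arc:
  assumes A: "closed_disk A" and B: "closed_disk B" and "connected (A \<inter> B)"
    and sub: "A \<inter> B \<subseteq> frontier A" "A \<inter> B \<subseteq> frontier B"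
    and ne: "A \<inter> B \<noteq> frontier A" "A \<inter> B \<noteq> frontier B" "\<not> (\<exists>x. A \<inter> B \<subseteq> {x})"
  shows "closed_disk (A \<union> B)"
proof -
  have cl: "closed A" "closed B" "compact A" "compact B"
    using A B by (simp_all add: closed_disk_compact compact_imp_closed)
  obtain f f' where f: "homeomorphism A upper_box f f'" "f ` (A \<inter> B) = box_base"
    by (rule disk_arc_box_form[OF A _ assms(3) sub(1) ne(1,3)]) (use cl in auto)
  obtain g g' where g: "homeomorphism B upper_box g g'" "g ` (A \<inter> B) = box_base"
    by (rule disk_arc_box_form[OF B _ assms(3) sub(2) ne(2,3)]) (use cl in auto)
  note fs = homeomorphism_apply1[OF f(1)] homeomorphism_apply2[OF f(1)]
    and gs = homeomorphism_apply1[OF g(1)] homeomorphism_apply2[OF g(1)]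
  have fA: "f z \<in> upper_box" if "z \<in> A" for z using that homeomorphism_image1[OF f(1)] by blast
  have gB: "g z \<in> upper_box" if "z \<in> B" for z using that homeomorphism_image1[OF g(1)] by blast
  have g'B: "g' z \<in> B" if "z \<in> upper_box" for z using that homeomorphism_image2[OF g(1)] by blast
  have base: "z \<in> box_base \<longleftrightarrow> z \<in> upper_box \<and> Im z = 0" for z
    by (cases z) (auto simp: in_cbox_Complex)
  have fb: "f z \<in> box_base \<longleftrightarrow> z \<in> B" if "z \<in> A" for z
  proof
    assume "f z \<in> box_base"
    then obtain y where "y \<in> A \<inter> B" "f z = f y" using f(2) by (metis imageE)
    then show "z \<in> B" using fs(1) that by (metis IntE)
  qed (use f(2) that in blast)
  have gb: "g z \<in> box_base \<longleftrightarrow> z \<in> A" if "z \<in> B" for z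
  proof
    assume "g z \<in> box_base"
    then obtain y where "y \<in> A \<inter> B" "g z = g y" using g(2) by (metis imageE)
    then show "z \<in> A" using gs(1) that by (metis IntE)
  qed (use g(2) that in blast)
  \<comment> \<open>In the chart \<open>g\<close>, this drops a point of \<open>B\<close> vertically
    to the base, hence to a point of the common arc.\<close>
  define u where "u z = g' (Complex (Re (g z)) 0)" for z
  have cb: "Complex (Re (g z)) 0 \<in> box_base" if "z \<in> B" for z
    using gB[OF that] by (auto simp: in_cbox_Complex)
  have u: "u z \<in> A \<inter> B" "g (u z) = Complex (Re (g z)) 0" if "z \<in> B" for z
  proof -
    show 1: "g (u z) = Complex (Re (g z)) 0"
      unfolding u_def using cb[OF that] base gs(2) by blast
    have "u z \<in> B" unfolding u_def using cb[OF that] base g'B by blast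
    then show "u z \<in> A \<inter> B" using gb[of "u z"] unfolding 1 using cb[OF that] by blast
  qed
  \<comment> \<open>The horizontal coordinate is replaced by the one that \<open>f\<close> gives to
    the foot \<open>u z\<close>, which makes \<open>G\<close> agree with \<open>f\<close> on the
    common arc; the minus sign reflects \<open>B\<close> below the base.\<close>
  define G where "G z = Complex (Re (f (u z))) (- Im (g z))" for z
  have fu: "f (u z) = Complex (Re (f (u z))) 0" if "z \<in> B" for z
    using fb[of "u z"] u[OF that] base[of "f (u z)"] by (simp add: complex_eq_iff)
  have u_id: "u z = z" if "z \<in> A \<inter> B" for z
  proof -
    have "Im (g z) = 0" using gb[of z] base that by blast
    then have "Complex (Re (g z)) 0 = g z" by (simp add: complex_eq_iff)
    then show ?thesis unfolding u_def using gs(1) that by simp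
  qed
  have Gf: "G z = f z" if "z \<in> A \<inter> B" for z
  proof -
    have "Im (g z) = 0" using gb[of z] base that by blast
    then show ?thesis unfolding G_def using fu[of z] u_id[OF that] that by simp
  qed
  define F where "F z = (if z \<in> A then f z else G z)" for z
  have FA: "F z = f z" if "z \<in> A" for z using that by (simp add: F_def)
  have FB: "F z = G z" if "z \<in> B" for z using that Gf by (simp add: F_def)
  have contG: "continuous_on B G"
  proof -
    have cg: "continuous_on B g" using g(1) homeomorphism_cont1 by blast
    have "continuous_on B (\<lambda>z. Complex (Re (g z)) 0)"
      unfolding Complex_eq by (intro continuous_intros cg)
    then have "continuous_on B u"
      unfolding u_def
      by (rule continuous_on_compose2[OF homeomorphism_cont2[OF g(1)]]) (use cb base in blast)
    then have "continuous_on B (\<lambda>z. f (u z))"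
      by (rule continuous_on_compose2[OF homeomorphism_cont1[OF f(1)]]) (use u in blast)
    then show ?thesis
      unfolding G_def Complex_eq by (intro continuous_intros cg)
  qed
  have "continuous_on (A \<union> B) F"
    unfolding F_def
    by (rule continuous_on_cases) (use cl contG Gf homeomorphism_cont1[OF f(1)] in auto)
  moreover have "inj_on F (A \<union> B)"
  proof -
    have GG: "z = w" if "z \<in> B" "w \<in> B" "G z = G w" for z w
    proof -
      have eq: "Re (f (u z)) = Re (f (u w))" "Im (g z) = Im (g w)"
        using that(3) by (auto simp: G_def)
      then have "f (u z) = f (u w)" using fu that by (simp add: complex_eq_iff)
      then have "u z = u w" using fs(1) u that by (metis IntE)
      then have "Re (g z) = Re (g w)" using u(2) that by (metis complex.inject)
      then have "g z = g w" using eq(2) by (simp add: complex_eq_iff)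
      then show ?thesis using gs(1) that by metis
    qed
    \<comment> \<open>The two halves share only the base, and there \<open>G\<close> is
      \<open>f\<close>.\<close>
    have fG: "z = w" if "z \<in> A" "w \<in> B" "f z = G w" for z w
    proof -
      have "Im (f z) \<ge> 0" "Im (g w) \<ge> 0" using fA[OF that(1)] gB[OF that(2)] by (auto simp: in_cbox_Complex)
      moreover have "Im (f z) = - Im (g w)" using that(3) by (simp add: G_def)
      ultimately have "Im (f z) = 0" "Im (g w) = 0" by auto
      then have "f z \<in> box_base" "g w \<in> box_base"
        unfolding base using fA[OF that(1)] gB[OF that(2)] by auto
      then have "z \<in> B" "w \<in> A" using fb[OF that(1)] gb[OF that(2)] by blast+
      then show ?thesis using Gf fs(1) that by (metis IntI)
    qed
    show ?thesis
    proof (rule inj_onI)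
      fix z w assume zw: "z \<in> A \<union> B" "w \<in> A \<union> B" "F z = F w"
      consider "z \<in> A" "w \<in> A" | "z \<in> A" "w \<in> B" | "z \<in> B" "w \<in> A" | "z \<in> B" "w \<in> B"
        using zw by blast
      then show "z = w"
        using zw(3) GG fG fG[symmetric] FA FB fs(1) by cases metis+
    qed
  qed
  moreover have "F ` (A \<union> B) = cbox (Complex (-1) (-1)) (Complex 1 1)"
  proof
    show "F ` (A \<union> B) \<subseteq> cbox (Complex (-1) (-1)) (Complex 1 1)"
    proof clarify
      fix z assume "z \<in> A \<union> B"
      moreover have "F z \<in> cbox (Complex (-1) (-1)) (Complex 1 1)" if "z \<in> A"
        using FA[OF that] fA[OF that] by (auto simp: in_cbox_Complex)
      moreover have "F z \<in> cbox (Complex (-1) (-1)) (Complex 1 1)" if "z \<in> B"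
        using FB[OF that] gB[OF that] fA[of "u z"] u(1)[OF that] by (auto simp: in_cbox_Complex G_def)
      ultimately show "F z \<in> cbox (Complex (-1) (-1)) (Complex 1 1)" by blast
    qed
    show "cbox (Complex (-1) (-1)) (Complex 1 1) \<subseteq> F ` (A \<union> B)"
    proof
      fix w assume w: "w \<in> cbox (Complex (-1) (-1)) (Complex 1 1)"
      show "w \<in> F ` (A \<union> B)"
      proof (cases "Im w \<ge> 0")
        case True
        then have "w \<in> upper_box" using w by (auto simp: in_cbox_Complex)
        then obtain a where "a \<in> A" "w = f a" using homeomorphism_image1[OF f(1)] by (metis imageE)
        then show ?thesis using FA by (metis UnCI imageI)
      next
        case False
        \<comment> \<open>The foot \<open>a\<close> is found from the horizontal coordinate of
          \<open>w\<close> in the chart \<open>f\<close>; then \<open>b\<close> lies above it at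
          height \<open>- Im w\<close> in the chart \<open>g\<close>.\<close>
        have "Complex (Re w) 0 \<in> f ` (A \<inter> B)" unfolding f(2) using w by (auto simp: in_cbox_Complex)
        then obtain a where a: "a \<in> A \<inter> B" "f a = Complex (Re w) 0" by (metis imageE)
        have ga: "g a = Complex (Re (g a)) 0"
          using gb[of a] a(1) base[of "g a"] by (simp add: complex_eq_iff)
        define b where "b = g' (Complex (Re (g a)) (- Im w))"
        have "Complex (Re (g a)) (- Im w) \<in> upper_box"
          using gB[of a] a(1) w False by (auto simp: in_cbox_Complex)
        then have b: "b \<in> B" "g b = Complex (Re (g a)) (- Im w)"
          unfolding b_def using g'B gs(2) by auto
        have ub: "u b = a" unfolding u_def b(2) using ga gs(1)[of a] a(1) by simp
        have "G b = w" unfolding G_def ub b(2) a(2) by simp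
        then show ?thesis using FB[OF b(1)] b(1) by (metis UnCI imageI)
      qed
    qed
  qed
  ultimately obtain F' where "homeomorphism (A \<union> B) (cbox (Complex (-1) (-1)) (Complex 1 1)) F F'"
    using homeomorphism_compact[of "A \<union> B" F] cl by (metis compact_Un)
  then have "A \<union> B homeomorphic cbox (Complex (-1) (-1)) (Complex 1 1)"
    unfolding homeomorphic_def by blast
  moreover have "closed_disk (cbox (Complex (-1) (-1)) (Complex 1 1))"
    by (rule closed_disk_convex) (use interior_cbox_Complex[of "-1" 1 "-1" 1] in auto)
  ultimately show ?thesis
    unfolding closed_disk_def using homeomorphic_trans by blast
qed

section \<open>Finite disk tilings\<close>

lemma connectedI_basepoint:
  assumes "\<And>y. y \<in> S \<Longrightarrow> \<exists>C. connected C \<and> C \<subseteq> S \<and> p \<in> C \<and> y \<in> C"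
  shows "connected S"
proof -
  have "connected (\<Union>{C. connected C \<and> C \<subseteq> S \<and> p \<in> C})"
    by (rule connected_Union) auto
  moreover have "\<Union>{C. connected C \<and> C \<subseteq> S \<and> p \<in> C} = S"
    using assms by blast
  ultimately show ?thesis by simp
qed

text \<open>An arc is homeomorphic to a segment and does not separate the plane. Hence the arc along
  which a tile is attached cannot be the whole frontier of the disk on the other side.\<close>

lemma connected_complement_boundary_arc:
  assumes "closed_disk A" "closed \<gamma>" "connected \<gamma>" "\<gamma> \<subseteq> frontier A" "\<gamma> \<noteq> frontier A"
    "\<not> (\<exists>x. \<gamma> \<subseteq> {x})"
  shows "connected (- \<gamma>)"
proof -
  obtain f g where fg: "homeomorphism A upper_box f g" "f ` \<gamma> = box_base"
    using disk_arc_box_form[OF assms] .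
  have "\<gamma> \<subseteq> A"
    using assms(1,4) closed_disk_compact compact_imp_closed frontier_subset_closed by blast
  then have "homeomorphism \<gamma> box_base f g"
    using fg homeomorphism_of_subsets[OF fg(1)] homeomorphism_image2[OF fg(1)]
    by (metis homeomorphism_image1 homeomorphism_of_subsets image_mono)
  moreover have "convex box_base" "compact box_base"
  proof -
    have "closed_segment (Complex (-1) 0) (Complex 1 0) = box_base"
      by (rule closed_segment_same_Im[THEN trans]) (auto simp: closed_segment_eq_real_ivl complex_eq_iff image_iff)
    then show "convex box_base" "compact box_base"
      by (metis convex_closed_segment, metis compact_segment)
  qed
  ultimately show ?thesis
    using connected_complement_homeomorphic_convex_compact[of \<gamma> box_base]
    unfolding homeomorphic_def by auto
qed

text \<open>The last condition forbids contact at a mere corner: some common point has a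
  neighbourhood covered by the two tiles. As \<open>\<Union>T\<close> has an outer boundary of its
  own, the hypothesis \<open>\<Union>S \<subseteq> interior (\<Union>T)\<close> recurs below; this
  margin puts a tile outside \<open>S\<close> at every boundary point of
  \<open>\<Union>S\<close>.\<close>

locale finite_tiling =
  fixes T :: "complex set set"
  assumes finite_tiles: "finite T"
    and tile_disk: "c \<in> T \<Longrightarrow> closed_disk c"
    and interior_tile_disjoint: "\<lbrakk>c \<in> T; d \<in> T; c \<noteq> d\<rbrakk> \<Longrightarrow> interior c \<inter> d = {}"
    and tiles_meet_along_edge:
      "\<lbrakk>c \<in> T; d \<in> T; c \<noteq> d; c \<inter> d \<noteq> {}\<rbrakk> \<Longrightarrow> \<exists>x\<in>c \<inter> d. x \<in> interior (c \<union> d)"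
begin

lemma closed_tile: "c \<in> T \<Longrightarrow> closed c"
  using tile_disk closed_disk_compact compact_imp_closed by blast

lemma compact_Union_tiles: "S \<subseteq> T \<Longrightarrow> compact (\<Union>S)"
  using finite_tiles tile_disk closed_disk_compact by (intro compact_Union) (auto dest: finite_subset)

lemma closed_Union_tiles: "S \<subseteq> T \<Longrightarrow> closed (\<Union>S)"
  using compact_Union_tiles compact_imp_closed by blast

lemma tile_subset_closure: "c \<in> T \<Longrightarrow> c \<subseteq> closure (interior c)"
  using tile_disk closed_disk_interior(3) by blast

lemma tile_interior_nonempty: "c \<in> T \<Longrightarrow> interior c \<noteq> {}"
  using tile_disk closed_disk_interior(2) by blast

lemma interior_tile_disjoint_Union:
  assumes "c \<in> T" "S \<subseteq> T" "c \<notin> S"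
  shows "interior c \<inter> \<Union>S = {}"
  using assms interior_tile_disjoint by blast

lemma tile_meets_open:
  assumes "c \<in> T" "open N" "x \<in> c" "x \<in> N"
  shows "interior c \<inter> N \<noteq> {}"
  using assms tile_subset_closure[OF assms(1)] open_Int_closure_eq_empty[of N "interior c"] by blast

text \<open>A third tile through the point would have interior points arbitrarily near it, hence
  inside \<open>c \<union> d\<close>, against disjointness.\<close>

lemma edge_point:
  assumes "c \<in> T" "d \<in> T" "c \<noteq> d" "c \<inter> d \<noteq> {}"
  obtains x where "x \<in> c" "x \<in> d" "x \<in> interior (c \<union> d)" "\<And>e. e \<in> T \<Longrightarrow> x \<in> e \<Longrightarrow> e = c \<or> e = d"
proof -
  obtain x where x: "x \<in> c \<inter> d" "x \<in> interior (c \<union> d)"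
    using tiles_meet_along_edge[OF assms] by blast
  have "e = c \<or> e = d" if "e \<in> T" "x \<in> e" for e
  proof (rule ccontr)
    assume "\<not> (e = c \<or> e = d)"
    then have "interior e \<inter> (c \<union> d) = {}"
      using interior_tile_disjoint that(1) assms(1,2) by blast
    then show False
      using tile_meets_open[OF that(1) open_interior that(2) x(2)] interior_subset by blast
  qed
  then show ?thesis using that x by blast
qed

text \<open>A ball without its centre is connected, so two closed sets that meet only at the centre
  cannot cover it while both reach beyond the centre.\<close>

lemma edge_not_singleton:
  assumes "c \<in> T" "d \<in> T" "c \<noteq> d" "c \<inter> d \<noteq> {}"
  shows "\<not> (\<exists>y. c \<inter> d \<subseteq> {y})"
proof
  assume "\<exists>y. c \<inter> d \<subseteq> {y}"
  then obtain x where x: "c \<inter> d = {x}" "x \<in> interior (c \<union> d)"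
    using tiles_meet_along_edge[OF assms] by blast
  then obtain r where r: "r > 0" "ball x r \<subseteq> c \<union> d"
    by (metis mem_interior)
  have "connected (ball x r - {x})"
    by (rule connected_punctured_ball) auto
  then have "c \<inter> (ball x r - {x}) = {} \<or> d \<inter> (ball x r - {x}) = {}"
    by (rule connected_closedD) (use r x closed_tile assms in auto)
  moreover have "e \<inter> (ball x r - {x}) \<noteq> {}" if "e = c \<or> e = d" for e
  proof -
    have "x \<in> e" "e \<in> T" using that assms(1,2) x(1) by auto
    then have "interior e \<inter> ball x r \<noteq> {}"
      using tile_meets_open[of e "ball x r" x] r(1) by auto
    moreover have "x \<notin> interior e"
      using that interior_tile_disjoint assms(1-3) x(1) by blast
    ultimately show ?thesis using interior_subset[of e] by auto
  qed
  ultimately show False by metis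
qed

text \<open>A tile keeps its interior, so it stays in one piece when other tiles are taken away;
  what \<open>\<Union>S\<close> leaves of it therefore lies in a single complementary
  component.\<close>

lemma connected_tile_diff:
  assumes "c \<in> T" "S \<subseteq> T" "c \<notin> S"
  shows "connected (c - \<Union>S)"
proof (rule connected_intermediate_closure)
  show "connected (interior c)"
    using closed_disk_interior(1) tile_disk assms(1) by blast
  show "interior c \<subseteq> c - \<Union>S"
    using interior_tile_disjoint_Union[OF assms] interior_subset by blast
  show "c - \<Union>S \<subseteq> closure (interior c)"
    using tile_subset_closure[OF assms(1)] by blast
qed

text \<open>A separation by closed sets cannot split a connected tile, and subfamilies of tiles have
  closed unions. So connectedness is that of the finite graph of touching tiles, where pieces can be
  counted.\<close>

lemma connected_Union_tiles_iff:
  assumes "S \<subseteq> T"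
  shows "connected (\<Union>S) \<longleftrightarrow> (\<forall>A\<subseteq>S. A \<noteq> {} \<and> (\<forall>a\<in>A. \<forall>b\<in>S - A. a \<inter> b = {}) \<longrightarrow> A = S)"
proof
  assume conn: "connected (\<Union>S)"
  show "\<forall>A\<subseteq>S. A \<noteq> {} \<and> (\<forall>a\<in>A. \<forall>b\<in>S - A. a \<inter> b = {}) \<longrightarrow> A = S"
  proof (intro allI impI, elim conjE)
    fix A assume A: "A \<subseteq> S" "A \<noteq> {}" "\<forall>a\<in>A. \<forall>b\<in>S - A. a \<inter> b = {}"
    have "\<Union>A \<inter> \<Union>S = {} \<or> \<Union>(S - A) \<inter> \<Union>S = {}"
      by (rule connected_closedD[OF conn]) (use A assms closed_Union_tiles[of A] closed_Union_tiles[of "S - A"] in auto)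
    moreover have "c \<noteq> {}" if "c \<in> S" for c
      using tile_interior_nonempty assms interior_subset that by blast
    ultimately show "A = S" using A(1,2) by blast
  qed
next
  assume *: "\<forall>A\<subseteq>S. A \<noteq> {} \<and> (\<forall>a\<in>A. \<forall>b\<in>S - A. a \<inter> b = {}) \<longrightarrow> A = S"
  show "connected (\<Union>S)"
    unfolding connected_closed
  proof (rule notI, elim exE conjE)
    fix E F assume EF: "closed E" "closed F" "\<Union>S \<subseteq> E \<union> F" "E \<inter> F \<inter> \<Union>S = {}" "E \<inter> \<Union>S \<noteq> {}" "F \<inter> \<Union>S \<noteq> {}"
    have one: "E \<inter> c = {} \<or> F \<inter> c = {}" if "c \<in> S" for c
      by (rule connected_closedD[of c]) (use EF that assms closed_disk_connected[OF tile_disk] in auto)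
    define A where "A = {c \<in> S. c \<inter> E \<noteq> {}}"
    have "a \<inter> b = {}" if "a \<in> A" "b \<in> S - A" for a b
      using that one[of a] EF(3) unfolding A_def by blast
    moreover have "A \<subseteq> S" "A \<noteq> {}" using EF(5) unfolding A_def by auto
    ultimately have "A = S" using * by simp
    then show False using one EF(6) unfolding A_def by blast
  qed
qed

text \<open>If no tile outside \<open>S\<close> contained \<open>x\<close>, removing the closed
  union of these tiles from \<open>interior (\<Union>T)\<close> would leave a neighbourhood of
  \<open>x\<close> inside \<open>\<Union>S\<close>.\<close>

lemma boundary_tile:
  assumes "S \<subseteq> T" "x \<in> frontier (\<Union>S)" "x \<in> interior (\<Union>T)"
  obtains c d where "c \<in> S" "d \<in> T - S" "x \<in> c" "x \<in> d"
proof -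
  have "x \<in> \<Union>S"
    using assms(1,2) closed_Union_tiles frontier_subset_closed by blast
  moreover have "x \<in> \<Union>(T - S)"
  proof (rule ccontr)
    assume "x \<notin> \<Union>(T - S)"
    then have "x \<in> interior (\<Union>T) \<inter> - \<Union>(T - S)" using assms(3) by blast
    moreover have "open (interior (\<Union>T) \<inter> - \<Union>(T - S))"
      using closed_Union_tiles[of "T - S"] by (intro open_Int open_interior) auto
    moreover have "interior (\<Union>T) \<inter> - \<Union>(T - S) \<subseteq> \<Union>S"
      using interior_subset by blast
    ultimately have "x \<in> interior (\<Union>S)" by (meson interiorI)
    then show False using assms(2) by (simp add: frontier_def)
  qed
  ultimately show ?thesis using that by blast
qed

text \<open>Among the pieces \<open>A\<close> that a boundary tile \<open>c\<close> cuts off from \<open>S - {c}\<close>, take one with the fewest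
  tiles.  As the frontier of \<open>c\<close> is connected, \<open>A\<close> contains a boundary tile, and removing that tile
  keeps the union connected: otherwise it would cut off a smaller piece.\<close>

lemma removable_boundary_tile:
  assumes S: "S \<subseteq> T" "\<Union>S \<subseteq> interior (\<Union>T)" "connected (\<Union>S)" and two: "c0 \<in> S" "S \<noteq> {c0}"
  obtains c d where "c \<in> S" "d \<in> T - S" "c \<inter> d \<noteq> {}" "connected (\<Union>(S - {c}))"
proof -
  define bd where "bd c \<longleftrightarrow> c \<in> S \<and> (\<exists>d\<in>T - S. c \<inter> d \<noteq> {})" for c
  define cut where "cut c A \<longleftrightarrow> bd c \<and> A \<subseteq> S - {c} \<and> A \<noteq> {} \<and> (\<forall>a\<in>A. \<forall>b\<in>S - {c} - A. a \<inter> b = {})" for c A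
  have conn: "A = S" if "A \<subseteq> S" "A \<noteq> {}" "\<And>a b. a \<in> A \<Longrightarrow> b \<in> S - A \<Longrightarrow> a \<inter> b = {}" for A
    using S(3) that unfolding connected_Union_tiles_iff[OF S(1)] by blast
  have "\<exists>c. bd c"
  proof -
    have "c0 \<in> T" using two(1) S(1) by blast
    then have "c0 \<noteq> {}" using tile_interior_nonempty[of c0] by auto
    then have "\<Union>S \<noteq> {}" using two(1) by blast
    moreover have "\<Union>S \<noteq> UNIV"
      using compact_imp_bounded[OF compact_Union_tiles[OF S(1)]] not_bounded_UNIV by metis
    ultimately have "frontier (\<Union>S) \<noteq> {}" by (simp add: frontier_eq_empty)
    then obtain x where x: "x \<in> frontier (\<Union>S)" by blast
    then have "x \<in> interior (\<Union>T)"
      using frontier_subset_closed[OF closed_Union_tiles[OF S(1)]] S(2) by (meson subsetD)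
    then obtain c d where "c \<in> S" "d \<in> T - S" "x \<in> c" "x \<in> d"
      using boundary_tile[OF S(1) x] by metis
    then show ?thesis unfolding bd_def by blast
  qed
  then obtain c1 where "bd c1" by blast
  \<comment> \<open>The whole remainder counts as a piece, so a minimal pair exists even when no
    tile disconnects the union.\<close>
  then have "cut c1 (S - {c1})"
    using two unfolding cut_def bd_def by blast
  then have "\<exists>p. cut (fst p) (snd p)" by auto
  then obtain p where p: "cut (fst p) (snd p)"
      and pmin: "\<And>q. cut (fst q) (snd q) \<Longrightarrow> card (snd p) \<le> card (snd q)"
    using exists_least_iff[of "\<lambda>n. \<exists>p. cut (fst p) (snd p) \<and> card (snd p) = n"]
    by (metis not_less)
  define c A where "c = fst p" and "A = snd p"
  have c: "cut c A" and min: "\<And>c' A'. cut c' A' \<Longrightarrow> card A \<le> card A'"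
    using p pmin[of "(_, _)"] unfolding c_def A_def by auto
  have cS: "c \<in> S" and A: "A \<subseteq> S - {c}" "A \<noteq> {}" and sep: "\<And>a b. a \<in> A \<Longrightarrow> b \<in> S - {c} - A \<Longrightarrow> a \<inter> b = {}"
    using c unfolding cut_def bd_def by auto
  have cT: "c \<in> T" using cS S(1) by blast
  obtain d0 where d0: "d0 \<in> T - S" "c \<inter> d0 \<noteq> {}"
    using c unfolding cut_def bd_def by blast
  have "\<exists>a\<in>A. bd a"
  proof -
    have "\<exists>a\<in>A. \<exists>b\<in>S - A. a \<inter> b \<noteq> {}"
    proof (rule ccontr)
      assume *: "\<not> (\<exists>a\<in>A. \<exists>b\<in>S - A. a \<inter> b \<noteq> {})"
      have "A = S" by (rule conn) (use A * in auto)
      then show False using A(1) cS by blast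
    qed
    then obtain a0 b where a0: "a0 \<in> A" "b \<in> S" "b \<notin> A" "a0 \<inter> b \<noteq> {}" by blast
    then have "b = c" using sep[of a0 b] by blast
    then have a0: "a0 \<in> A" "a0 \<inter> c \<noteq> {}" using a0 by auto
    have fr: "frontier c = c - interior c"
      using closed_tile[OF cT] by (simp add: frontier_def)
    have meet: "c \<inter> e \<subseteq> frontier c" if "e \<in> T" "e \<noteq> c" for e
      unfolding fr using interior_tile_disjoint[OF cT that(1)] that(2) by blast
    have cover: "frontier c \<subseteq> \<Union>A \<union> \<Union>(T - A - {c})"
    proof
      fix x assume x: "x \<in> frontier c"
      then have "x \<in> interior (\<Union>T)" using S(2) cS fr by blast
      then obtain d where "d \<in> T - {c}" "x \<in> d"
        using boundary_tile[of "{c}" x] x cT by auto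
      then show "x \<in> \<Union>A \<union> \<Union>(T - A - {c})" by blast
    qed
    \<comment> \<open>The frontier of \<open>c\<close> meets the piece \<open>A\<close>, and through
      \<open>d0\<close> it also meets the tiles other than \<open>c\<close> outside
      \<open>A\<close>. Being connected, it has a point on both, and the tile \<open>e\<close> there
      lies outside \<open>S\<close>, since no tile of \<open>S - {c}\<close> outside
      \<open>A\<close> touches \<open>A\<close>.\<close>
    have "\<not> (\<Union>A \<inter> \<Union>(T - A - {c}) \<inter> frontier c = {})"
    proof
      assume *: "\<Union>A \<inter> \<Union>(T - A - {c}) \<inter> frontier c = {}"
      have "\<Union>A \<inter> frontier c = {} \<or> \<Union>(T - A - {c}) \<inter> frontier c = {}"
        by (rule connected_closedD[OF closed_disk_frontier(2)[OF tile_disk[OF cT]] * cover])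
           (use A(1) S(1) in \<open>auto intro!: closed_Union_tiles\<close>)
      moreover have "\<Union>A \<inter> frontier c \<noteq> {}"
        using a0 meet[of a0] A(1) S(1) by blast
      moreover have "\<Union>(T - A - {c}) \<inter> frontier c \<noteq> {}"
        using d0 meet[of d0] A(1) cS by blast
      ultimately show False by blast
    qed
    then obtain a e where ae: "a \<in> A" "e \<in> T - A - {c}" "a \<inter> e \<noteq> {}" by blast
    then have "e \<notin> S" using sep by blast
    then show ?thesis using ae A(1) unfolding bd_def by blast
  qed
  then obtain a where a: "a \<in> A" "bd a" by blast
  have aS: "a \<in> S" using a A by blast
  have "connected (\<Union>(S - {a}))"
  proof (rule ccontr)
    assume "\<not> connected (\<Union>(S - {a}))"
    then obtain B0 where B0: "B0 \<subseteq> S - {a}" "B0 \<noteq> {}" "B0 \<noteq> S - {a}" "\<forall>x\<in>B0. \<forall>y\<in>S - {a} - B0. x \<inter> y = {}"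
      using connected_Union_tiles_iff[of "S - {a}"] S(1) by blast
    \<comment> \<open>The side of the separation that avoids \<open>c\<close>.\<close>
    define B where "B = (if c \<in> B0 then S - {a} - B0 else B0)"
    have B: "B \<subseteq> S - {a}" "B \<noteq> {}" "c \<notin> B" "\<And>x y. x \<in> B \<Longrightarrow> y \<in> S - {a} - B \<Longrightarrow> x \<inter> y = {}"
      using B0 unfolding B_def by (auto split: if_splits)
    \<comment> \<open>A part of \<open>B\<close> outside \<open>A\<close> would be isolated in
      \<open>S\<close>: beyond itself \<open>A\<close> touches only \<open>c\<close>, and
      \<open>B\<close> touches only \<open>a\<close>, which is in \<open>A\<close>. It would then be
      all of \<open>S\<close>, though it misses \<open>c\<close>.\<close>
    have "B - A = {}"
    proof (rule ccontr)
      assume ne: "B - A \<noteq> {}"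
      have "B - A = S"
      proof (rule conn)
        show "B - A \<subseteq> S" using B(1) by blast
        fix x y assume xy: "x \<in> B - A" "y \<in> S - (B - A)"
        show "x \<inter> y = {}"
        proof (cases "y \<in> A")
          case True
          have "x \<in> S - {c} - A" using xy(1) B(1,3) by blast
          then show ?thesis using sep[OF True] by blast
        next
          case False
          then have "y \<in> S - {a} - B" using xy(2) a(1) by blast
          then show ?thesis using B(4) xy(1) by blast
        qed
      qed (rule ne)
      then show False using cS B(3) by blast
    qed
    then have "B \<subset> A" using B(1) a(1) by blast
    moreover have "finite A" using A(1) S(1) finite_tiles by (meson Diff_subset finite_subset order_trans)
    ultimately have "card B < card A" by (simp add: psubset_card_mono)
    moreover have "cut a B" using a(2) B unfolding cut_def by blast
    ultimately show False using min by (simp add: leD)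
  qed
  then show ?thesis using that a(2) unfolding bd_def by blast
qed

text \<open>The outside tile \<open>d\<close> that touches the removed tile \<open>c\<close> does
  double duty: their edge point keeps the complement connected, and it shows that the attaching set
  is not the whole frontier of \<open>c\<close>.\<close>

lemma closed_disk_Union_tiles:
  assumes "S \<subseteq> T" "S \<noteq> {}" "\<Union>S \<subseteq> interior (\<Union>T)" "connected (\<Union>S)" "connected (- \<Union>S)"
  shows "closed_disk (\<Union>S)"
  using assms
proof (induction "card S" arbitrary: S rule: less_induct)
  case less
  note S = less.prems
  obtain c0 where c0: "c0 \<in> S" using S(2) by blast
  show ?case
  proof (cases "S = {c0}")
    case True
    then show ?thesis using tile_disk S(1) by simp
  next
    case False
    obtain c d where cd: "c \<in> S" "d \<in> T - S" "c \<inter> d \<noteq> {}" and conn': "connected (\<Union>(S - {c}))"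
      using removable_boundary_tile[OF S(1,3,4) c0 False] .
    define S' where "S' = S - {c}"
    have S': "S' \<subseteq> T" "c \<notin> S'" "S = insert c S'" "S' \<noteq> {}" and cT: "c \<in> T"
      using S(1) cd(1) False c0 unfolding S'_def by auto
    obtain x where x: "x \<in> c" "x \<in> d" and only: "\<And>e. e \<in> T \<Longrightarrow> x \<in> e \<Longrightarrow> e = c \<or> e = d"
      using edge_point[of c d] cd cT by blast
    have dT: "d \<in> T" "d \<notin> S" using cd(2) by auto
    have xS': "x \<notin> \<Union>S'" using only S' dT by blast
    have intc: "interior c \<inter> \<Union>S' = {}"
      using interior_tile_disjoint_Union[OF cT S'(1,2)] .
    \<comment> \<open>The edge point \<open>x\<close> lies on the outside tile \<open>d\<close> and
      on no tile of \<open>S'\<close>, so it joins the old complement to what the removal of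
      \<open>c\<close> uncovers.\<close>
    have "connected (- \<Union>S')"
    proof -
      have "x \<in> closure (- \<Union>S)"
        using interior_tile_disjoint_Union[OF dT(1) S(1) dT(2)] x(2) tile_subset_closure[OF dT(1)]
        by (meson closure_mono disjoint_eq_subset_Compl subsetD)
      then have "connected (insert x (- \<Union>S))"
        by (intro connected_intermediate_closure[OF S(5)]) (auto intro: closure_subset[THEN subsetD])
      then have "connected (insert x (- \<Union>S) \<union> (c - \<Union>S'))"
        using connected_tile_diff[OF cT S'(1,2)] x xS' by (intro connected_Un) auto
      moreover have "insert x (- \<Union>S) \<union> (c - \<Union>S') = - \<Union>S'"
        using xS' S'(3) by auto
      ultimately show ?thesis by simp
    qed
    moreover have "card S' < card S"
      unfolding S'_def using cd(1) S(1) finite_tiles by (meson card_Diff1_less finite_subset)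
    moreover have "\<Union>S' \<subseteq> interior (\<Union>T)" using S(3) S'(3) by blast
    ultimately have disk': "closed_disk (\<Union>S')"
      using less.hyps[of S'] S' conn' unfolding S'_def by blast
    have comp: "compact (\<Union>S)" "compact (\<Union>S')" "compact c"
      using compact_Union_tiles S(1) S'(1) cT tile_disk closed_disk_compact by blast+
    have eq: "\<Union>S = \<Union>S' \<union> c" using S'(3) by auto
    define \<gamma> where "\<gamma> = \<Union>S' \<inter> c"
    have \<gamma>conn: "connected \<gamma>"
    proof -
      \<comment> \<open>A compact plane set with connected complement is Borsukian, hence
        unicoherent, so its closed connected parts \<open>\<Union>S'\<close> and \<open>c\<close>
        meet in a connected set.\<close>
      have "unicoherent (\<Union>S)"
        using S(5) comp(1) Borsukian_separation_compact Borsukian_imp_unicoherent by blast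
      then show ?thesis unfolding \<gamma>_def
        by (rule unicoherentD)
           (use conn' S'_def eq closed_disk_connected[OF tile_disk[OF cT]] comp in
             \<open>auto intro!: closed_subset compact_imp_closed\<close>)
    qed
    have \<gamma>c: "\<gamma> \<subseteq> frontier c"
      using intc closed_tile[OF cT] unfolding \<gamma>_def frontier_def by auto
    have \<gamma>S': "\<gamma> \<subseteq> frontier (\<Union>S')"
    proof
      fix y assume y: "y \<in> \<gamma>"
      have "y \<notin> interior (\<Union>S')"
        using tile_meets_open[OF cT open_interior, of y "\<Union>S'"] y intc interior_subset
        unfolding \<gamma>_def by blast
      then show "y \<in> frontier (\<Union>S')"
        using y comp(2) unfolding \<gamma>_def by (simp add: frontier_def compact_imp_closed)
    qed
    have "x \<in> frontier c"
      using x interior_tile_disjoint[OF cT dT(1)] cd(1) dT(2) closed_tile[OF cT]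
      unfolding frontier_def by auto
    then have ne1: "\<gamma> \<noteq> frontier c" using xS' unfolding \<gamma>_def by blast
    \<comment> \<open>As \<open>\<Union>S\<close> is connected, \<open>c\<close> touches some tile
      of \<open>S'\<close>, and their common edge is more than a point.\<close>
    have nt: "\<not> (\<exists>y. \<gamma> \<subseteq> {y})"
    proof -
      obtain e where e: "e \<in> S'" "c \<inter> e \<noteq> {}"
      proof -
        have "\<exists>e\<in>S - {c}. c \<inter> e \<noteq> {}"
        proof (rule ccontr)
          assume "\<not> (\<exists>e\<in>S - {c}. c \<inter> e \<noteq> {})"
          then have "{c} = S"
            using S(4) cd(1) unfolding connected_Union_tiles_iff[OF S(1)] by blast
          then show False using S'(2,3,4) by blast
        qed
        then show ?thesis using that unfolding S'_def by blast
      qed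
      then have "c \<inter> e \<subseteq> \<gamma>" "e \<in> T" "c \<noteq> e" using S' unfolding \<gamma>_def by auto
      then show ?thesis using edge_not_singleton[OF cT _ _ e(2)] by blast
    qed
    have "closed \<gamma>" unfolding \<gamma>_def using comp compact_imp_closed by blast
    then have "connected (- \<gamma>)"
      by (rule connected_complement_boundary_arc[OF tile_disk[OF cT] _ \<gamma>conn \<gamma>c ne1 nt])
    \<comment> \<open>Otherwise \<open>\<gamma>\<close> would separate the interior of
      \<open>\<Union>S'\<close> from its complement.\<close>
    have ne2: "\<gamma> \<noteq> frontier (\<Union>S')"
    proof
      assume *: "\<gamma> = frontier (\<Union>S')"
      have "interior (\<Union>S') \<inter> - \<gamma> = {} \<or> - \<Union>S' \<inter> - \<gamma> = {}"
      proof (rule connectedD[OF \<open>connected (- \<gamma>)\<close>])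
        show "open (- \<Union>S')" using comp(2) by (simp add: compact_imp_closed open_Compl)
        show "interior (\<Union>S') \<inter> - \<Union>S' \<inter> - \<gamma> = {}" using interior_subset by blast
        show "- \<gamma> \<subseteq> interior (\<Union>S') \<union> - \<Union>S'"
          unfolding * using comp(2) by (auto simp: frontier_def compact_imp_closed)
      qed simp
      moreover have "interior (\<Union>S') \<inter> - \<gamma> \<noteq> {}"
        using closed_disk_interior(2)[OF disk'] * by (auto simp: frontier_def)
      moreover have "x \<in> - \<Union>S' \<inter> - \<gamma>" using xS' unfolding \<gamma>_def by blast
      ultimately show False by blast
    qed
    show ?thesis
      unfolding eq
      by (rule closed_disk_Un_along_arc[OF disk' tile_disk[OF cT]]; unfold \<gamma>_def[symmetric])
         (fact \<gamma>conn \<gamma>S' \<gamma>c ne1 ne2 nt)+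
  qed
qed

end

section \<open>Complementary components of a union of tiles\<close>

context finite_tiling
begin

text \<open>An edge point of two touching tiles is interior to their union and adherent to both tile
  interiors, so it is a bridge between them. A corner contact would provide none.\<close>

lemma connected_interior_Union_tiles:
  assumes S: "S \<subseteq> T" and "connected (\<Union>S)"
  shows "connected (interior (\<Union>S))"
proof (cases "S = {}")
  case False
  then obtain c0 where c0: "c0 \<in> S" by blast
  define K where "K = \<Union>S"
  have intc: "interior c \<subseteq> interior K" if "c \<in> S" for c
    unfolding K_def by (rule interior_mono) (use that in blast)
  have "c0 \<in> T" using c0 S by blast
  then obtain p where p: "p \<in> interior c0" using tile_interior_nonempty[of c0] by blast
  define G where "G = {c \<in> S. \<exists>q\<in>interior c. connected_component (interior K) p q}"
  have conn_c: "connected (interior c)" if "c \<in> S" for c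
    using closed_disk_interior(1) tile_disk S that by (meson subsetD)
  have all: "connected_component (interior K) p q" if c: "c \<in> G" and q: "q \<in> c" "q \<in> interior K" for c q
  proof -
    have cS: "c \<in> S" using c unfolding G_def by blast
    obtain r where r: "r \<in> interior c" "connected_component (interior K) p r"
      using c unfolding G_def by blast
    have "connected (insert q (interior c))"
      by (rule connected_intermediate_closure[OF conn_c[OF cS]])
         (use tile_subset_closure[of c] cS S q(1) closure_subset in auto)
    moreover have "insert q (interior c) \<subseteq> interior K" using intc[OF cS] q(2) by auto
    ultimately have "connected_component (interior K) r q"
      unfolding connected_component_def using r(1) by (intro exI[of _ "insert q (interior c)"]) auto
    then show ?thesis using r(2) connected_component_trans by metis
  qed
  have "G = S"
  proof -
    have "connected_component (interior K) p p"
      using p intc[OF c0] by (intro connected_component_refl) blast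
    then have "c0 \<in> G" using p c0 unfolding G_def by blast
    moreover have "a \<inter> b = {}" if ab: "a \<in> G" "b \<in> S - G" for a b
    proof (rule ccontr)
      assume "a \<inter> b \<noteq> {}"
      moreover have abT: "a \<in> T" "b \<in> T" "a \<noteq> b" and abS: "a \<in> S" "b \<in> S"
        using ab S unfolding G_def by auto
      ultimately obtain x where x: "x \<in> a" "x \<in> b" "x \<in> interior (a \<union> b)"
        using edge_point by metis
      have "interior (a \<union> b) \<subseteq> interior K"
        unfolding K_def by (rule interior_mono) (use abS in blast)
      then have xK: "x \<in> interior K" using x(3) by blast
      have 1: "connected_component (interior K) p x" using all[OF ab(1) x(1) xK] .
      obtain r where r: "r \<in> interior b" using tile_interior_nonempty[OF abT(2)] by blast
      have "connected (insert x (interior b))"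
        by (rule connected_intermediate_closure[OF conn_c[OF abS(2)]])
           (use tile_subset_closure[OF abT(2)] x(2) closure_subset in auto)
      moreover have "insert x (interior b) \<subseteq> interior K" using intc[OF abS(2)] xK by auto
      ultimately have "connected_component (interior K) x r"
        unfolding connected_component_def using r by (intro exI[of _ "insert x (interior b)"]) auto
      with 1 have "connected_component (interior K) p r" using connected_component_trans by metis
      then have "b \<in> G" using r abS(2) unfolding G_def by blast
      then show False using ab(2) by blast
    qed
    moreover have "G \<subseteq> S" unfolding G_def by blast
    ultimately show ?thesis
      using assms(2) unfolding connected_Union_tiles_iff[OF S] by (metis empty_iff)
  qed
  have "connected_component_set (interior K) p = interior K"
  proof
    show "interior K \<subseteq> connected_component_set (interior K) p"
    proof
      fix q assume q: "q \<in> interior K"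
      then obtain c where "c \<in> S" "q \<in> c" unfolding K_def using interior_subset by (metis UnionE subsetD)
      then show "q \<in> connected_component_set (interior K) p"
        using all[of c q] q \<open>G = S\<close> by simp
    qed
  qed (rule connected_component_subset)
  then show ?thesis unfolding K_def using connected_connected_component by metis
qed simp

lemma Union_tiles_subset_closure_interior:
  assumes "S \<subseteq> T"
  shows "\<Union>S \<subseteq> closure (interior (\<Union>S))"
proof (rule Union_least)
  fix c assume c: "c \<in> S"
  have "interior c \<subseteq> interior (\<Union>S)" by (rule interior_mono) (use c in blast)
  then show "c \<subseteq> closure (interior (\<Union>S))"
    using tile_subset_closure[of c] c assms closure_mono by blast
qed

text \<open>The other components are open and together form the complement of
  \<open>H \<union> \<Union>S\<close>, which is therefore closed.\<close>

lemma closure_component_complement: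
  assumes "S \<subseteq> T" "H \<in> components (- \<Union>S)"
  shows "closure H \<subseteq> H \<union> \<Union>S"
proof -
  have "closed (H \<union> \<Union>S)"
  proof -
    have "open H" using open_components[OF _ assms(2)] closed_Union_tiles[OF assms(1)] by blast
    have "- (H \<union> \<Union>S) = \<Union>(components (- \<Union>S) - {H})"
    proof
      show "- (H \<union> \<Union>S) \<subseteq> \<Union>(components (- \<Union>S) - {H})"
        using Union_components[of "- \<Union>S"] by blast
      show "\<Union>(components (- \<Union>S) - {H}) \<subseteq> - (H \<union> \<Union>S)"
      proof (rule Union_least)
        fix H' assume H': "H' \<in> components (- \<Union>S) - {H}"
        then have "H \<inter> H' = {}" "H' \<subseteq> - \<Union>S"
          using components_nonoverlap[OF assms(2), of H'] in_components_subset by auto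
        then show "H' \<subseteq> - (H \<union> \<Union>S)" by blast
      qed
    qed
    moreover have "open (\<Union>(components (- \<Union>S) - {H}))"
      using open_components closed_Union_tiles[OF assms(1)] by (intro open_Union) blast
    ultimately show ?thesis by (simp add: closed_def)
  qed
  then show ?thesis by (rule closure_minimal[rotated]) blast
qed

text \<open>Only the interior is required to lie in \<open>H\<close>, since the tiles along the
  frontier of \<open>H\<close> reach \<open>\<Union>S\<close>.\<close>

definition tiles_in :: "complex set \<Rightarrow> complex set set" where
  "tiles_in H = {d \<in> T. interior d \<subseteq> H}"

lemma tile_diff_subset_component:
  assumes "S \<subseteq> T" "H \<in> components (- \<Union>S)" "d \<in> T" "d \<notin> S" "x \<in> d" "x \<in> H"
  shows "d - \<Union>S \<subseteq> H"
proof -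
  have "x \<in> d - \<Union>S" using assms(2,5,6) in_components_subset by blast
  then show ?thesis
    using components_maximal[OF assms(2) connected_tile_diff[OF assms(3,1,4)]] assms(6) by blast
qed

text \<open>A tile meeting \<open>H\<close> has its interior in \<open>H\<close>, so these tiles
  cover \<open>H\<close> within \<open>interior (\<Union>T)\<close>; being finite in number, they
  have a closed union, which also contains the limit points.\<close>

lemma closure_component_tiles:
  assumes S: "S \<subseteq> T" and H: "H \<in> components (- \<Union>S)"
    and z: "z \<in> closure H" "z \<in> interior (\<Union>T)"
  shows "z \<in> \<Union>(tiles_in H)"
proof -
  have "interior (\<Union>T) \<inter> H \<subseteq> \<Union>(tiles_in H)"
  proof
    fix x assume x: "x \<in> interior (\<Union>T) \<inter> H"
    then obtain d where d: "d \<in> T" "x \<in> d" using interior_subset by blast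
    have "x \<notin> \<Union>S" using x in_components_subset[OF H] by blast
    then have dS: "d \<notin> S" using d(2) by blast
    have "interior d \<subseteq> d - \<Union>S"
      using interior_tile_disjoint_Union[OF d(1) S dS] interior_subset by blast
    then have "interior d \<subseteq> H"
      using tile_diff_subset_component[OF S H d(1) dS d(2)] x by blast
    then show "x \<in> \<Union>(tiles_in H)" using d unfolding tiles_in_def by blast
  qed
  moreover have "closed (\<Union>(tiles_in H))"
    by (rule closed_Union_tiles) (auto simp: tiles_in_def)
  ultimately have "closure (interior (\<Union>T) \<inter> H) \<subseteq> \<Union>(tiles_in H)"
    by (rule closure_minimal)
  moreover have "interior (\<Union>T) \<inter> closure H \<subseteq> closure (interior (\<Union>T) \<inter> H)"
    by (rule open_Int_closure_subset) simp
  ultimately show ?thesis using z by blast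
qed

lemma tiles_in_subset_closure: "\<Union>(tiles_in H) \<subseteq> closure H"
proof (rule Union_least)
  fix d assume "d \<in> tiles_in H"
  then have "d \<subseteq> closure (interior d)" "interior d \<subseteq> H"
    using tile_subset_closure unfolding tiles_in_def by auto
  then show "d \<subseteq> closure H" using closure_mono by blast
qed

lemma tiles_in_component:
  assumes "S \<subseteq> T" "H \<in> components (- \<Union>S)" "d \<in> tiles_in H"
  shows "d \<in> T" "d \<notin> S" "d - \<Union>S \<subseteq> H"
proof -
  show d: "d \<in> T" using assms(3) unfolding tiles_in_def by blast
  have dH: "interior d \<subseteq> H" using assms(3) unfolding tiles_in_def by blast
  obtain x where x: "x \<in> interior d" using tile_interior_nonempty[OF d] by blast
  then have "x \<in> H" "x \<in> d" using dH interior_subset by auto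
  moreover have "x \<notin> \<Union>S" using \<open>x \<in> H\<close> in_components_subset[OF assms(2)] by blast
  ultimately show "d \<notin> S" by blast
  then show "d - \<Union>S \<subseteq> H"
    using tile_diff_subset_component[OF assms(1,2) d] \<open>x \<in> H\<close> \<open>x \<in> d\<close> by blast
qed

text \<open>A common point would lie on a tile from each side. An edge point of these two tiles is
  on no third tile, so it escapes \<open>\<Union>S\<close> and belongs to both components.\<close>

lemma disjoint_closures_components:
  assumes S: "S \<subseteq> T" "\<Union>S \<subseteq> interior (\<Union>T)"
    and H: "H \<in> components (- \<Union>S)" "H' \<in> components (- \<Union>S)" "H \<noteq> H'"
  shows "closure H \<inter> closure H' = {}"
proof (rule ccontr)
  assume "closure H \<inter> closure H' \<noteq> {}"
  then obtain z where z: "z \<in> closure H" "z \<in> closure H'" by blast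
  have dis: "H \<inter> H' = {}" using components_nonoverlap H by blast
  have "z \<in> H \<union> \<Union>S" "z \<in> H' \<union> \<Union>S"
    using closure_component_complement[OF S(1) H(1)] closure_component_complement[OF S(1) H(2)] z by auto
  then have "z \<in> interior (\<Union>T)" using dis S(2) by blast
  then have "z \<in> \<Union>(tiles_in H)" "z \<in> \<Union>(tiles_in H')"
    using closure_component_tiles[OF S(1) H(1)] closure_component_tiles[OF S(1) H(2)] z by auto
  then obtain d d' where d: "d \<in> tiles_in H" "z \<in> d" and d': "d' \<in> tiles_in H'" "z \<in> d'"
    by blast
  note dd = tiles_in_component[OF S(1) H(1) d(1)] and dd' = tiles_in_component[OF S(1) H(2) d'(1)]
  have "interior d \<noteq> {}" using tile_interior_nonempty[OF dd(1)] .
  then have "d \<noteq> d'" using d(1) d'(1) dis unfolding tiles_in_def by blast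
  moreover have "d \<inter> d' \<noteq> {}" using d d' by blast
  ultimately obtain x where x: "x \<in> d" "x \<in> d'" and only: "\<And>e. e \<in> T \<Longrightarrow> x \<in> e \<Longrightarrow> e = d \<or> e = d'"
    using edge_point[OF dd(1) dd'(1)] by metis
  have "x \<notin> \<Union>S"
  proof
    assume "x \<in> \<Union>S"
    then obtain e where "e \<in> S" "x \<in> e" by blast
    then show False using only[of e] S(1) dd(2) dd'(2) by blast
  qed
  then have "x \<in> H \<inter> H'" using x dd(3) dd'(3) by blast
  then show False using dis by blast
qed

text \<open>\<open>\<Union>S - closure H\<close> is connected because it lies between the interior
  of \<open>\<Union>S\<close> and the closure of that interior. Every other component is attached to
  it at a frontier point, which disjointness of closures keeps off \<open>closure H\<close>.\<close>

lemma connected_complement_closure_component: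
  assumes S: "S \<subseteq> T" "\<Union>S \<subseteq> interior (\<Union>T)" "connected (\<Union>S)" "S \<noteq> {}"
    and H: "H \<in> components (- \<Union>S)"
  shows "connected (- closure H)"
proof -
  define K where "K = \<Union>S"
  have HK: "H \<subseteq> - K" using in_components_subset[OF H] unfolding K_def .
  have dis: "interior K \<inter> closure H = {}"
    using open_Int_closure_eq_empty[of "interior K" H] HK interior_subset by blast
  have core: "connected (K - closure H)"
  proof (rule connected_intermediate_closure)
    show "connected (interior K)" unfolding K_def by (rule connected_interior_Union_tiles[OF S(1,3)])
    show "interior K \<subseteq> K - closure H" using dis interior_subset by blast
    show "K - closure H \<subseteq> closure (interior K)"
      using Union_tiles_subset_closure_interior[OF S(1)] unfolding K_def by blast
  qed
  obtain c where c: "c \<in> S" using S(4) by blast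
  have "interior c \<subseteq> interior K" unfolding K_def by (rule interior_mono) (use c in blast)
  moreover have "c \<in> T" using c S(1) by blast
  ultimately obtain p where "p \<in> interior K" using tile_interior_nonempty[of c] by blast
  then have p: "p \<in> K - closure H" using dis interior_subset by blast
  show ?thesis
  proof (rule connectedI_basepoint)
    fix y assume y: "y \<in> - closure H"
    show "\<exists>C. connected C \<and> C \<subseteq> - closure H \<and> p \<in> C \<and> y \<in> C"
    proof (cases "y \<in> K")
      case True
      then show ?thesis using core p y by (intro exI[of _ "K - closure H"]) auto
    next
      case False
      then obtain H' where H': "H' \<in> components (- K)" "y \<in> H'"
        using Union_components[of "- K"] by blast
      have "H \<noteq> H'" using y H'(2) closure_subset by blast
      then have disj: "closure H \<inter> closure H' = {}"
        using disjoint_closures_components[OF S(1,2) H] H'(1) unfolding K_def by blast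
      have "frontier H' \<noteq> {}"
        unfolding frontier_eq_empty using H' p in_components_subset[OF H'(1)] by auto
      then obtain z where z: "z \<in> frontier H'" by blast
      have zc: "z \<in> closure H'" using z by (simp add: frontier_def)
      have "open H'" using open_components[OF _ H'(1)] closed_Union_tiles[OF S(1)] unfolding K_def by blast
      then have "z \<notin> H'" using z by (simp add: frontier_def interior_open)
      then have "z \<in> K"
        using closure_component_complement[OF S(1), of H'] H'(1) zc unfolding K_def by blast
      have "connected (insert z H')"
        by (rule connected_intermediate_closure[OF in_components_connected[OF H'(1)]])
           (use zc closure_subset in auto)
      then have "connected (insert z H' \<union> (K - closure H))"
        using core \<open>z \<in> K\<close> zc disj by (intro connected_Un) auto
      moreover have "insert z H' \<union> (K - closure H) \<subseteq> - closure H"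
        using zc disj closure_subset[of H'] by auto
      ultimately show ?thesis using p H'(2) by blast
    qed
  qed
qed

section \<open>Filling the holes of a union of tiles\<close>

definition fill :: "complex set \<Rightarrow> complex set set" where
  "fill K = {d \<in> T. d \<subseteq> K \<union> inside K}"

text \<open>A tile outside \<open>S\<close> that enters a hole stays within that hole and
  \<open>\<Union>S\<close>, since its part outside \<open>\<Union>S\<close> is connected.\<close>

lemma Union_fill:
  assumes S: "S \<subseteq> T" "inside (\<Union>S) \<subseteq> \<Union>T"
  shows "\<Union>(fill (\<Union>S)) = \<Union>S \<union> inside (\<Union>S)"
proof
  show "\<Union>(fill (\<Union>S)) \<subseteq> \<Union>S \<union> inside (\<Union>S)" unfolding fill_def by blast
  show "\<Union>S \<union> inside (\<Union>S) \<subseteq> \<Union>(fill (\<Union>S))"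
  proof
    fix x assume x: "x \<in> \<Union>S \<union> inside (\<Union>S)"
    show "x \<in> \<Union>(fill (\<Union>S))"
    proof (cases "x \<in> \<Union>S")
      case True
      then obtain c where "c \<in> S" "x \<in> c" by blast
      then show ?thesis using S(1) unfolding fill_def by blast
    next
      case False
      then have xi: "x \<in> inside (\<Union>S)" using x by blast
      then obtain d where d: "d \<in> T" "x \<in> d" using S(2) by blast
      have dS: "d \<notin> S" using d(2) False by blast
      have "d - \<Union>S \<subseteq> inside (\<Union>S)"
      proof
        fix y assume y: "y \<in> d - \<Union>S"
        have "connected_component (- \<Union>S) x y"
          unfolding connected_component_def
          using connected_tile_diff[OF d(1) S(1) dS] d(2) False y
          by (intro exI[of _ "d - \<Union>S"]) auto
        then show "y \<in> inside (\<Union>S)" using xi inside_same_component by metis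
      qed
      then show ?thesis using d unfolding fill_def by blast
    qed
  qed
qed

text \<open>After filling, the complement is \<open>outside (\<Union>S)\<close>, which is connected
  because \<open>\<Union>S\<close> is bounded.\<close>

lemma closed_disk_fill:
  assumes S: "S \<subseteq> T" "S \<noteq> {}" "connected (\<Union>S)"
    and "\<Union>S \<union> inside (\<Union>S) \<subseteq> interior (\<Union>T)"
  shows "closed_disk (\<Union>S \<union> inside (\<Union>S))"
proof -
  have "inside (\<Union>S) \<subseteq> \<Union>T" using assms(4) interior_subset by blast
  then have eq: "\<Union>(fill (\<Union>S)) = \<Union>S \<union> inside (\<Union>S)" using Union_fill S(1) by blast
  have "closed_disk (\<Union>(fill (\<Union>S)))"
  proof (rule closed_disk_Union_tiles)
    show "fill (\<Union>S) \<subseteq> T" unfolding fill_def by blast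
    have "S \<subseteq> fill (\<Union>S)" using S(1) unfolding fill_def by blast
    then show "fill (\<Union>S) \<noteq> {}" using S(2) by blast
    show "connected (\<Union>(fill (\<Union>S)))"
      unfolding eq using connected_with_inside[OF closed_Union_tiles[OF S(1)] S(3)] .
    show "connected (- \<Union>(fill (\<Union>S)))"
      unfolding eq outside_inside[symmetric]
      using compact_imp_bounded[OF compact_Union_tiles[OF S(1)]] by (intro connected_outside) auto
  qed (use eq assms(4) in simp)
  then show ?thesis unfolding eq .
qed

text \<open>The margin includes \<open>inside (\<Union>S)\<close> so that holes, too, are covered by
  tiles. The unbounded component is the exterior of the filled union; the closure of a bounded one
  is itself a union of tiles.\<close>

lemma frontier_component_circle:
  assumes S: "S \<subseteq> T" "S \<noteq> {}" "connected (\<Union>S)"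
    and sub: "\<Union>S \<union> inside (\<Union>S) \<subseteq> interior (\<Union>T)"
    and H: "H \<in> components (- \<Union>S)"
  shows "frontier H homeomorphic sphere (0::complex) 1"
proof (cases "bounded H")
  case False
  obtain x where x: "x \<in> H" using in_components_nonempty[OF H] by blast
  have Hx: "H = connected_component_set (- \<Union>S) x"
    using H x by (metis components_iff connected_component_eq)
  have "H \<subseteq> outside (\<Union>S)"
  proof
    fix y assume y: "y \<in> H"
    then have "connected_component_set (- \<Union>S) y = H" unfolding Hx by (metis connected_component_eq)
    then show "y \<in> outside (\<Union>S)" using False unfolding outside by simp
  qed
  moreover have "outside (\<Union>S) \<subseteq> H"
  proof (rule components_maximal[OF H])
    show "connected (outside (\<Union>S))"
      using compact_imp_bounded[OF compact_Union_tiles[OF S(1)]] by (intro connected_outside) auto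
    show "outside (\<Union>S) \<subseteq> - \<Union>S" using outside_no_overlap by blast
    show "H \<inter> outside (\<Union>S) \<noteq> {}" using calculation x by blast
  qed
  ultimately have "H = - (\<Union>S \<union> inside (\<Union>S))" unfolding outside_inside[symmetric] by blast
  then show ?thesis
    using closed_disk_frontier(1)[OF closed_disk_fill[OF S sub]] by (simp only: frontier_complement)
next
  case True
  have HK: "H \<subseteq> - \<Union>S" using in_components_subset[OF H] .
  have "H \<subseteq> inside (\<Union>S)"
  proof
    fix y assume y: "y \<in> H"
    then have "connected_component_set (- \<Union>S) y = H"
      using H by (metis components_iff connected_component_eq)
    then show "y \<in> inside (\<Union>S)" using True y HK unfolding inside_def by auto
  qed
  then have clos: "closure H \<subseteq> interior (\<Union>T)"
    using closure_component_complement[OF S(1) H] sub by blast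
  have eq: "\<Union>(tiles_in H) = closure H"
    using closure_component_tiles[OF S(1) H] tiles_in_subset_closure clos by blast
  have sub': "\<Union>S \<subseteq> interior (\<Union>T)" using sub by blast
  have "closed_disk (\<Union>(tiles_in H))"
  proof (rule closed_disk_Union_tiles)
    show "tiles_in H \<subseteq> T" unfolding tiles_in_def by blast
    have "closure H \<noteq> {}" using in_components_nonempty[OF H] by simp
    then show "tiles_in H \<noteq> {}" unfolding eq[symmetric] by blast
    show "\<Union>(tiles_in H) \<subseteq> interior (\<Union>T)" unfolding eq by (rule clos)
    show "connected (\<Union>(tiles_in H))"
      unfolding eq using in_components_connected[OF H] by (rule connected_imp_connected_closure)
    show "connected (- \<Union>(tiles_in H))"
      unfolding eq by (rule connected_complement_closure_component[OF S(1) sub' S(3,2) H])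
  qed
  then have "frontier (closure H) homeomorphic sphere (0::complex) 1"
    unfolding eq by (rule closed_disk_frontier(1))
  \<comment> \<open>Closing up \<open>H\<close> could swallow frontier points. It does not: near any
    point of \<open>\<Union>S\<close> there are interiors of tiles of \<open>S\<close>, and these
    avoid \<open>closure H\<close>.\<close>
  moreover have "frontier (closure H) = frontier H"
  proof -
    have "open H" using open_components[OF _ H] closed_Union_tiles[OF S(1)] by blast
    have "z \<in> H" if z: "z \<in> interior (closure H)" for z
    proof (rule ccontr)
      assume "z \<notin> H"
      moreover have "z \<in> H \<union> \<Union>S"
        using z interior_subset closure_component_complement[OF S(1) H] by blast
      ultimately obtain c where c: "c \<in> S" "z \<in> c" by blast
      have "c \<in> T" using c S(1) by blast
      then have "interior c \<inter> interior (closure H) \<noteq> {}"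
        using tile_meets_open[OF _ open_interior c(2) z] by blast
      then have "interior c \<inter> closure H \<noteq> {}" using interior_subset by blast
      then have "interior c \<inter> H \<noteq> {}" using open_Int_closure_eq_empty[OF open_interior] by blast
      moreover have "interior c \<subseteq> \<Union>S" using c(1) interior_subset by blast
      ultimately show False using HK by blast
    qed
    then have "interior (closure H) = H"
      using \<open>open H\<close> closure_subset interior_maximal by blast
    then show ?thesis using \<open>open H\<close> by (simp add: frontier_def interior_open)
  qed
  ultimately show ?thesis by simp
qed

lemma frontier_Union_tiles_circles:
  assumes S: "S \<subseteq> T" "S \<noteq> {}" "connected (\<Union>S)"
    and sub: "\<Union>S \<union> inside (\<Union>S) \<subseteq> interior (\<Union>T)"
  obtains C where "\<And>Y. Y \<in> C \<Longrightarrow> Y homeomorphic sphere (0::complex) 1"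
    "pairwise disjnt C" "\<Union>C = frontier (\<Union>S)"
proof
  let ?C = "frontier ` components (- \<Union>S)"
  show "Y homeomorphic sphere (0::complex) 1" if "Y \<in> ?C" for Y
    using that frontier_component_circle[OF assms] by blast
  have sub': "\<Union>S \<subseteq> interior (\<Union>T)" using sub by blast
  show "pairwise disjnt ?C"
  proof (rule pairwiseI)
    fix Y Y' assume "Y \<in> ?C" "Y' \<in> ?C" "Y \<noteq> Y'"
    then obtain H H' where H: "H \<in> components (- \<Union>S)" "H' \<in> components (- \<Union>S)" "H \<noteq> H'"
      "Y = frontier H" "Y' = frontier H'" by blast
    then show "disjnt Y Y'"
      using disjoint_closures_components[OF S(1) sub' H(1-3)] unfolding disjnt_def frontier_def by blast
  qed
  have cl: "closed (\<Union>S)" using closed_Union_tiles[OF S(1)] .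
  show "\<Union>?C = frontier (\<Union>S)"
  proof
    show "\<Union>?C \<subseteq> frontier (\<Union>S)"
    proof (rule Union_least)
      fix Y assume "Y \<in> ?C"
      then show "Y \<subseteq> frontier (\<Union>S)"
        using frontier_of_components_subset[of _ "- \<Union>S"] by (auto simp: frontier_complement)
    qed
    \<comment> \<open>A frontier point lies on a tile outside \<open>S\<close> whose interior is in
      one component, so it is a limit of that single component and not merely of the
      complement.\<close>
    show "frontier (\<Union>S) \<subseteq> \<Union>?C"
    proof
      fix x assume x: "x \<in> frontier (\<Union>S)"
      then have xS: "x \<in> \<Union>S" using frontier_subset_closed[OF cl] by blast
      then have "x \<in> interior (\<Union>T)" using sub' by blast
      then obtain d where d: "d \<in> T - S" "x \<in> d" using boundary_tile[OF S(1) x] by metis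
      have dT: "d \<in> T" "d \<notin> S" using d by auto
      obtain y where y: "y \<in> interior d" using tile_interior_nonempty[OF dT(1)] by blast
      have "y \<in> - \<Union>S" using y interior_tile_disjoint_Union[OF dT(1) S(1) dT(2)] by blast
      then obtain H where H: "H \<in> components (- \<Union>S)" "y \<in> H" using Union_components[of "- \<Union>S"] by blast
      have "d - \<Union>S \<subseteq> H"
        using tile_diff_subset_component[OF S(1) H(1) dT _ H(2)] y interior_subset by blast
      moreover have "interior d \<subseteq> d - \<Union>S"
        using interior_tile_disjoint_Union[OF dT(1) S(1) dT(2)] interior_subset by blast
      ultimately have "closure (interior d) \<subseteq> closure H" by (intro closure_mono) blast
      then have "x \<in> closure H" using tile_subset_closure[OF dT(1)] d(2) by blast
      moreover have "x \<notin> interior H"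
        using xS in_components_subset[OF H(1)] interior_subset by blast
      ultimately show "x \<in> \<Union>?C" using H(1) unfolding frontier_def by blast
    qed
  qed
qed

end

section \<open>Bricks and their lifts\<close>

text \<open>Width 2, height 1, and every row is shifted by 1 against the row below. Letting the
  shift accumulate with \<open>j\<close> gives one formula for even and odd rows; all corners are
  integral.\<close>

definition brick :: "int \<Rightarrow> int \<Rightarrow> (real \<times> real) set" where
  "brick i j = {of_int (2*i + j)..of_int (2*i + j + 2)} \<times> {of_int j..of_int (j + 1)}"

lemma mem_brick:
  "(x, y) \<in> brick i j \<longleftrightarrow> of_int (2*i + j) \<le> x \<and> x \<le> of_int (2*i + j + 2) \<and> of_int j \<le> y \<and> y \<le> of_int (j + 1)"
  unfolding brick_def by auto

lemma interior_brick:
  "interior (brick i j) = {of_int (2*i + j)<..<of_int (2*i + j + 2)} \<times> {of_int j<..<of_int (j + 1)}"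
  unfolding brick_def interior_Times by (simp add: interior_atLeastAtMost_real)

lemma brick_covers: "\<exists>i j. p \<in> brick i j"
proof -
  obtain x y where p: "p = (x, y)" by fastforce
  define j i where "j = \<lfloor>y\<rfloor>" and "i = \<lfloor>(x - of_int j) / 2\<rfloor>"
  have "of_int i \<le> (x - of_int j) / 2" "(x - of_int j) / 2 < of_int i + 1" "of_int j \<le> y" "y < of_int j + 1"
    unfolding i_def j_def by linarith+
  then show ?thesis unfolding p mem_brick by (intro exI[of _ i] exI[of _ j]) auto
qed

lemma interior_brick_disjoint:
  assumes "(i, j) \<noteq> (i', j')"
  shows "interior (brick i j) \<inter> brick i' j' = {}"
proof (rule ccontr)
  assume "interior (brick i j) \<inter> brick i' j' \<noteq> {}"
  then obtain x y where "(x, y) \<in> interior (brick i j)" "(x, y) \<in> brick i' j'" by fastforce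
  then have 1: "of_int (2*i + j) < x" "x < of_int (2*i + j + 2)" "of_int j < y" "y < of_int (j + 1)"
    "of_int (2*i' + j') \<le> x" "x \<le> of_int (2*i' + j' + 2)" "of_int j' \<le> y" "y \<le> of_int (j' + 1)"
    unfolding interior_brick mem_brick by auto
  have "real_of_int j < of_int (j' + 1)" "real_of_int j' < of_int (j + 1)" using 1 by linarith+
  then have "j = j'" unfolding of_int_less_iff by linarith
  have "real_of_int (2*i + j) < of_int (2*i' + j' + 2)" "real_of_int (2*i' + j') < of_int (2*i + j + 2)"
    using 1 by linarith+
  then have "i = i'" unfolding of_int_less_iff \<open>j = j'\<close> by linarith
  then show False using assms \<open>j = j'\<close> by simp
qed

text \<open>Vertical sides in row \<open>j\<close> have abscissas of the parity of \<open>j\<close>,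
  so those of adjacent rows never line up and two bricks cannot meet in a corner alone.\<close>

lemma bricks_meet_along_edge:
  assumes "(i, j) \<noteq> (i', j')" "brick i j \<inter> brick i' j' \<noteq> {}"
  shows "\<exists>x\<in>brick i j \<inter> brick i' j'. x \<in> interior (brick i j \<union> brick i' j')"
proof -
  have horizontal: "\<exists>x\<in>brick i j \<inter> brick i' j'. x \<in> interior (brick i j \<union> brick i' j')" if "j' = j" "i' = i + 1" for i j i' j' :: int
  proof -
    let ?p = "(of_int (2*i + j + 2), of_int j + 1/2) :: real \<times> real"
    let ?U = "{of_int (2*i + j)<..<of_int (2*i + j + 4)} \<times> {of_int j<..<of_int (j + 1)} :: (real \<times> real) set"
    have "?U \<subseteq> brick i j \<union> brick i' j'" unfolding brick_def that by auto
    moreover have "open ?U" by (intro open_Times) auto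
    ultimately have "?U \<subseteq> interior (brick i j \<union> brick i' j')" by (rule interior_maximal)
    moreover have "?p \<in> ?U" by auto
    moreover have "?p \<in> brick i j \<inter> brick i' j'" unfolding brick_def that by auto
    ultimately show ?thesis by blast
  qed
  have vertical: "\<exists>x\<in>brick i j \<inter> brick i' j'. x \<in> interior (brick i j \<union> brick i' j')" if "j' = j + 1" "i' = i \<or> i' = i - 1" for i j i' j' :: int
  proof -
    \<comment> \<open>The left end of the common edge, which has length 1; the witness
      \<open>?p\<close> is the midpoint of that edge.\<close>
    define a where "a = real_of_int (max (2*i + j) (2*i' + j'))"
    let ?p = "(a + 1/2, of_int j + 1) :: real \<times> real"
    let ?U = "{a<..<a + 1} \<times> {of_int j<..<of_int j + 2} :: (real \<times> real) set"
    have a: "real_of_int (2*i + j) \<le> a" "real_of_int (2*i' + j') \<le> a"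
      "a + 1 \<le> real_of_int (2*i + j + 2)" "a + 1 \<le> real_of_int (2*i' + j' + 2)"
      using that unfolding a_def by (auto simp: max_def)
    have "?U \<subseteq> brick i j \<union> brick i' j'"
    proof clarify
      fix x y assume "x \<in> {a<..<a + 1}" "y \<in> {real_of_int j<..<of_int j + 2}" "(x, y) \<notin> brick i' j'"
      then show "(x, y) \<in> brick i j" using a that(1) unfolding mem_brick by auto
    qed
    moreover have "open ?U" by (intro open_Times) auto
    ultimately have "?U \<subseteq> interior (brick i j \<union> brick i' j')" by (rule interior_maximal)
    moreover have "?p \<in> ?U" by auto
    moreover have "?p \<in> brick i j \<inter> brick i' j'" using a that(1) by (auto simp: mem_brick)
    ultimately show ?thesis by blast
  qed
  obtain x y where "(x, y) \<in> brick i j" "(x, y) \<in> brick i' j'" using assms(2) by fastforce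
  then have 1: "of_int (2*i + j) \<le> x" "x \<le> of_int (2*i + j + 2)" "of_int j \<le> y" "y \<le> of_int (j + 1)"
    "of_int (2*i' + j') \<le> x" "x \<le> of_int (2*i' + j' + 2)" "of_int j' \<le> y" "y \<le> of_int (j' + 1)"
    unfolding mem_brick by auto
  have "real_of_int j \<le> of_int (j' + 1)" "real_of_int j' \<le> of_int (j + 1)"
    "real_of_int (2*i + j) \<le> of_int (2*i' + j' + 2)" "real_of_int (2*i' + j') \<le> of_int (2*i + j + 2)"
    using 1 by linarith+
  then have "j \<le> j' + 1" "j' \<le> j + 1" "2*i + j \<le> 2*i' + j' + 2" "2*i' + j' \<le> 2*i + j + 2"
    unfolding of_int_le_iff .
  \<comment> \<open>Over the integers, contact leaves only two neighbours in the same row and two in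
    each adjacent row.\<close>
  then consider "j' = j" "i' = i + 1" | "j = j'" "i = i' + 1"
    | "j' = j + 1" "i' = i \<or> i' = i - 1" | "j = j' + 1" "i = i' \<or> i = i' - 1"
    using assms(1) by fastforce
  then show ?thesis
    using horizontal[of j' j i' i] horizontal[of j j' i i'] vertical[of j' j i' i] vertical[of j j' i i']
    by cases (auto simp: Un_commute Int_commute)
qed

lemma brick_subset_cball:
  assumes "p \<in> brick i j"
  shows "brick i j \<subseteq> cball p 3"
proof
  fix q assume q: "q \<in> brick i j"
  obtain x y u v where p: "p = (x, y)" and qq: "q = (u, v)" by fastforce
  have "dist p q \<le> dist x u + dist y v"
    unfolding p qq dist_Pair_Pair by (rule sqrt_sum_squares_le_sum) auto
  also have "\<dots> \<le> 2 + 1"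
    using assms q unfolding p qq mem_brick dist_real_def by (intro add_mono) auto
  finally show "q \<in> cball p 3" by simp
qed

lemma finite_bricks_subset_ball: "finite {(i, j). brick i j \<subseteq> ball p R}"
proof -
  obtain a b where p: "p = (a, b)" by fastforce
  let ?J = "{\<lfloor>b - R\<rfloor>..\<lceil>b + R\<rceil>}"
  let ?I = "{\<lfloor>(a - R - \<lceil>b + R\<rceil>) / 2\<rfloor>..\<lceil>(a + R - \<lfloor>b - R\<rfloor>) / 2\<rceil>}"
  have "{(i, j). brick i j \<subseteq> ball p R} \<subseteq> ?I \<times> ?J"
  proof clarify
    fix i j assume "brick i j \<subseteq> ball p R"
    moreover have "(of_int (2*i + j), of_int j) \<in> brick i j" by (simp add: mem_brick)
    ultimately have d: "dist (a, b) (of_int (2*i + j), of_int j) < R" unfolding p by auto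
    have "dist a (of_int (2*i + j)) < R" "dist b (of_int j) < R"
      using d dist_fst_le[of "(a, b)" "(of_int (2*i + j), of_int j)"]
        dist_snd_le[of "(a, b)" "(of_int (2*i + j), of_int j)"] by auto
    then have 1: "a - R < of_int (2*i + j)" "of_int (2*i + j) < a + R" "b - R < of_int j" "of_int j < b + R"
      unfolding dist_real_def by linarith+
    have "of_int j \<le> real_of_int \<lceil>b + R\<rceil>" "real_of_int \<lfloor>b - R\<rfloor> \<le> of_int j"
      using 1(3,4) by linarith+
    then have "(a - R - \<lceil>b + R\<rceil>) / 2 \<le> of_int i" "of_int i \<le> (a + R - \<lfloor>b - R\<rfloor>) / 2"
      using 1(1,2) by auto
    then show "i \<in> ?I \<and> j \<in> ?J" using 1(3,4) by (auto, linarith+)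
  qed
  then show ?thesis by (rule finite_subset) auto
qed

lemma brick_homeomorphic_cball: "brick i j homeomorphic cball (0::complex) 1"
proof (rule homeomorphic_convex_compact_sets)
  show "convex (brick i j)" "compact (brick i j)"
    unfolding brick_def by (auto intro!: convex_Times compact_Times)
  have "(of_int (2*i + j) + 1, of_int j + 1/2) \<in> interior (brick i j)"
    unfolding interior_brick by auto
  then have "interior (brick i j) \<noteq> {}" by blast
  then show "aff_dim (brick i j) = aff_dim (cball (0::complex) 1)"
    by (simp add: aff_dim_nonempty_interior)
qed auto

section \<open>Lifts of bricks\<close>

definition cell :: "(complex \<Rightarrow> real \<times> real) \<Rightarrow> (real \<times> real) set \<Rightarrow> complex set \<Rightarrow> bool" where
  "cell D B c \<longleftrightarrow> (\<exists>g. homeomorphism c B D g)"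

text \<open>Uniqueness of lifts: the points of \<open>c\<close> at which the lift by
  \<open>g\<close> returns the point itself are exactly those in \<open>U\<close>. This set is open
  in \<open>c\<close> because \<open>U\<close> is open and closed because an equation defines it, so
  the connected \<open>c\<close> never leaves the sheet.\<close>

lemma cell_in_sheet:
  assumes U: "open U" "homeomorphism U V D g" and c: "cell D B c" "connected B" "B \<subseteq> V" "c \<inter> U \<noteq> {}"
  shows "c \<subseteq> U" "c = g ` B"
proof -
  obtain h where h: "homeomorphism c B D h" using c(1) unfolding cell_def by blast
  have Dc: "continuous_on c D" "D ` c = B" using h homeomorphism_cont1 homeomorphism_image1 by blast+
  have gU: "g z \<in> U" if "z \<in> V" for z using that homeomorphism_image2[OF U(2)] by blast
  have "connected c"
    using homeomorphism_cont2[OF h] homeomorphism_image2[OF h] c(2) connected_continuous_image by metis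
  have eq: "c \<inter> U = {z \<in> c. g (D z) - z = 0}"
  proof (intro set_eqI iffI)
    fix z assume "z \<in> {z \<in> c. g (D z) - z = 0}"
    then have z: "z \<in> c" "g (D z) = z" by auto
    then have "D z \<in> V" using Dc(2) c(3) by blast
    then have "g (D z) \<in> U" by (rule gU)
    then show "z \<in> c \<inter> U" using z by simp
  qed (use homeomorphism_apply1[OF U(2)] in auto)
  have "openin (top_of_set c) (c \<inter> U)" using U(1) by (rule openin_open_Int)
  moreover have "closedin (top_of_set c) (c \<inter> U)"
    unfolding eq
  proof (rule continuous_closedin_preimage_constant)
    have "continuous_on c (\<lambda>z. g (D z))"
      by (rule continuous_on_compose2[OF homeomorphism_cont2[OF U(2)] Dc(1)]) (use Dc(2) c(3) in simp)
    then show "continuous_on c (\<lambda>z. g (D z) - z)" by (intro continuous_intros)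
  qed
  ultimately have "c \<inter> U = {} \<or> c \<inter> U = c"
    using \<open>connected c\<close> unfolding connected_clopen by blast
  then show sub: "c \<subseteq> U" using c(4) by blast
  have "g (D z) = z" if "z \<in> c" for z using that sub homeomorphism_apply1[OF U(2)] by blast
  then show "c = g ` B" unfolding Dc(2)[symmetric] image_image by simp
qed

lemma sheet_homeomorphism:
  assumes "homeomorphism U V D g" "B \<subseteq> V"
  shows "homeomorphism (g ` B) B D g"
proof (rule homeomorphism_of_subsets[OF assms(1) _ assms(2)])
  show "g ` B \<subseteq> U" using assms homeomorphism_image2 by blast
  have "D (g z) = z" if "z \<in> B" for z using that assms homeomorphism_apply2 by blast
  then show "D ` g ` B = B" by (simp add: image_image)
qed

text \<open>The constant 7: bricks have diameter at most 3, so a brick through the centre of a sheet and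
  every brick touching it lie inside the sheet.\<close>

locale brick_sheets =
  fixes D :: "complex \<Rightarrow> real \<times> real" and M :: "complex set" and \<delta> :: real
  assumes M: "compact M" and contD: "continuous_on UNIV D"
    and sheet: "x \<in> M \<Longrightarrow> \<exists>U g. open U \<and> x \<in> U \<and> U \<subseteq> ball x \<delta> \<and> homeomorphism U (ball (D x) 7) D g"
begin

definition cells :: "complex set set" where
  "cells = {c. (\<exists>i j. cell D (brick i j) c) \<and> c \<inter> M \<noteq> {}}"

lemma connected_brick: "connected (brick i j)"
  unfolding brick_def by (intro convex_connected convex_Times) auto

lemma cell_through_point:
  assumes "x \<in> M"
  obtains c where "c \<in> cells" "x \<in> c"
proof -
  obtain U g where U: "open U" "x \<in> U" "homeomorphism U (ball (D x) 7) D g"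
    using sheet[OF assms] by blast
  obtain i j where ij: "D x \<in> brick i j" using brick_covers by blast
  then have B: "brick i j \<subseteq> ball (D x) 7" using brick_subset_cball by fastforce
  have x: "x \<in> g ` brick i j"
    using ij homeomorphism_apply1[OF U(3,2)] by (metis imageI)
  then have "g ` brick i j \<in> cells"
    using sheet_homeomorphism[OF U(3) B] assms unfolding cells_def cell_def by blast
  then show ?thesis using that x by blast
qed

lemma cell_subset_ball:
  assumes "c \<in> cells" "x \<in> c" "x \<in> M"
  shows "c \<subseteq> ball x \<delta>"
proof -
  obtain U g where U: "open U" "x \<in> U" "U \<subseteq> ball x \<delta>" "homeomorphism U (ball (D x) 7) D g"
    using sheet[OF assms(3)] by blast
  obtain i j where c: "cell D (brick i j) c" using assms(1) unfolding cells_def by blast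
  then have "D x \<in> brick i j" using assms(2) homeomorphism_image1 unfolding cell_def by blast
  then have "brick i j \<subseteq> ball (D x) 7" using brick_subset_cball by fastforce
  then show ?thesis using cell_in_sheet(1)[OF U(1,4) c connected_brick] assms(2) U(2,3) by blast
qed

text \<open>The sheet at a point of \<open>c\<close> in \<open>M\<close> has room for
  \<open>d\<close> as well, whose image stays within 3 + 3 < 7 of the centre. Questions about two
  touching cells thus become questions about two bricks.\<close>

lemma common_sheet:
  assumes "c \<in> cells" "d \<in> cells" "y \<in> c" "y \<in> d"
  obtains g i j i' j' where "homeomorphism (brick i j \<union> brick i' j') (c \<union> d) g D"
    "c = g ` brick i j" "d = g ` brick i' j'"
proof -
  obtain x where x: "x \<in> c" "x \<in> M" using assms(1) unfolding cells_def by blast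
  obtain U g where U: "open U" "x \<in> U" "homeomorphism U (ball (D x) 7) D g"
    using sheet[OF x(2)] by blast
  obtain i j where c: "cell D (brick i j) c" using assms(1) unfolding cells_def by blast
  obtain i' j' where d: "cell D (brick i' j') d" using assms(2) unfolding cells_def by blast
  have Dx: "D x \<in> brick i j" "D y \<in> brick i j" "D y \<in> brick i' j'"
    using x assms(3,4) c d homeomorphism_image1 unfolding cell_def by blast+
  have "brick i j \<subseteq> cball (D x) 3" "brick i' j' \<subseteq> cball (D y) 3"
    using Dx brick_subset_cball by auto
  moreover have "dist (D x) (D y) \<le> 3" using Dx(2) calculation(1) by auto
  moreover have "cball (D y) 3 \<subseteq> ball (D x) 7"
    using calculation(3) by (simp add: cball_subset_ball_iff dist_commute)
  ultimately have B: "brick i j \<subseteq> ball (D x) 7" "brick i' j' \<subseteq> ball (D x) 7"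
    by fastforce+
  have c': "c \<subseteq> U" "c = g ` brick i j"
    using cell_in_sheet[OF U(1,3) c connected_brick B(1)] x U(2) by blast+
  have d': "d = g ` brick i' j'"
    using cell_in_sheet(2)[OF U(1,3) d connected_brick B(2)] assms(3,4) c'(1) by blast
  have "homeomorphism (g ` (brick i j \<union> brick i' j')) (brick i j \<union> brick i' j') D g"
    using sheet_homeomorphism[OF U(3)] B by (meson Un_least)
  then have "homeomorphism (brick i j \<union> brick i' j') (c \<union> d) g D"
    unfolding c'(2) d' image_Un by (rule homeomorphism_symD)
  then show ?thesis using that c'(2) d' by blast
qed

text \<open>By compactness finitely many sheets suffice, and each contains only finitely many lifted
  bricks.\<close>

lemma finite_cells: "finite cells"
proof -
  obtain U g where U: "\<And>x. x \<in> M \<Longrightarrow> open (U x) \<and> x \<in> U x \<and> homeomorphism (U x) (ball (D x) 7) D (g x)"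
    using sheet by metis
  \<comment> \<open>Radius 1 leaves room: a brick through a point at distance less than 1 from the
    centre stays within 1 + 3 < 7.\<close>
  define N where "N x = U x \<inter> D -` ball (D x) 1" for x
  have "open (N x)" if "x \<in> M" for x
  proof -
    have "open (D -` ball (D x) 1)" using contD by (intro open_vimage) auto
    then show ?thesis using U[OF that] unfolding N_def by blast
  qed
  moreover have "M \<subseteq> (\<Union>x\<in>M. N x)" using U unfolding N_def by auto
  ultimately obtain F where F: "F \<subseteq> M" "finite F" "M \<subseteq> (\<Union>x\<in>F. N x)"
    using compactE_image[OF M] by metis
  have "cells \<subseteq> (\<Union>x\<in>F. (\<lambda>(i, j). g x ` brick i j) ` {(i, j). brick i j \<subseteq> ball (D x) 7})"
  proof
    fix c assume c: "c \<in> cells"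
    then obtain y where y: "y \<in> c" "y \<in> M" unfolding cells_def by blast
    obtain i j where ij: "cell D (brick i j) c" using c unfolding cells_def by blast
    obtain x where x: "x \<in> F" "y \<in> N x" using F(3) y(2) by blast
    have "D y \<in> brick i j" using y(1) ij homeomorphism_image1 unfolding cell_def by blast
    then have "brick i j \<subseteq> cball (D y) 3" by (rule brick_subset_cball)
    moreover have "cball (D y) 3 \<subseteq> ball (D x) 7"
      using x(2) unfolding N_def by (simp add: cball_subset_ball_iff dist_commute)
    ultimately have B: "brick i j \<subseteq> ball (D x) 7" by blast
    have "x \<in> M" using x(1) F(1) by blast
    note Ux = U[OF this]
    have "c = g x ` brick i j"
      by (rule cell_in_sheet(2)[of "U x" "ball (D x) 7" D, OF _ _ ij connected_brick B])
         (use Ux x(2) y(1) in \<open>auto simp: N_def\<close>)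
    then show "c \<in> (\<Union>x\<in>F. (\<lambda>(i, j). g x ` brick i j) ` {(i, j). brick i j \<subseteq> ball (D x) 7})"
      using x(1) B by blast
  qed
  then show ?thesis
    by (rule finite_subset) (intro finite_UN_I F(2) finite_imageI finite_bricks_subset_ball)
qed

text \<open>The conditions on pairs of cells are carried over from bricks by a common sheet;
  invariance of domain takes care of the interiors.\<close>

sublocale finite_tiling cells
proof
  show "finite cells" by (rule finite_cells)
  show "closed_disk c" if c: "c \<in> cells" for c
  proof -
    obtain i j where "cell D (brick i j) c" using c unfolding cells_def by blast
    then have "c homeomorphic brick i j" unfolding cell_def homeomorphic_def by blast
    then show ?thesis unfolding closed_disk_def
      using brick_homeomorphic_cball homeomorphic_trans by blast
  qed
next
  fix c d assume cd: "c \<in> cells" "d \<in> cells" "c \<noteq> d"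
  show "interior c \<inter> d = {}"
  proof (rule ccontr)
    assume "interior c \<inter> d \<noteq> {}"
    then obtain y where y: "y \<in> interior c" "y \<in> d" by blast
    then have "y \<in> c" using interior_subset by blast
    then obtain g i j i' j' where g: "homeomorphism (brick i j \<union> brick i' j') (c \<union> d) g D"
      and c: "c = g ` brick i j" and d: "d = g ` brick i' j'"
      using common_sheet[OF cd(1,2) _ y(2)] by metis
    have "homeomorphism (brick i j) c g D"
      by (rule homeomorphism_of_subsets[OF g]) (use c in auto)
    then have "g ` interior (brick i j) = interior c"
      by (rule homeomorphism_image_interior) simp
    then obtain p where p: "p \<in> interior (brick i j)" "y = g p" using y(1) by blast
    obtain q where q: "q \<in> brick i' j'" "y = g q" using y(2) d by blast
    have "p \<in> brick i j" using p(1) interior_subset by blast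
    then have "p = q" using p(2) q homeomorphism_apply1[OF g] by (metis UnCI)
    moreover have "(i, j) \<noteq> (i', j')" using cd(3) c d by auto
    ultimately show False using interior_brick_disjoint p(1) q(1) by blast
  qed
  assume "c \<inter> d \<noteq> {}"
  then obtain y where y: "y \<in> c" "y \<in> d" by blast
  then obtain g i j i' j' where g: "homeomorphism (brick i j \<union> brick i' j') (c \<union> d) g D"
    and c: "c = g ` brick i j" and d: "d = g ` brick i' j'"
    using common_sheet[OF cd(1,2)] by metis
  have "D (g q) = q" if "q \<in> brick i j \<union> brick i' j'" for q
    using homeomorphism_apply1[OF g that] .
  then have "D y \<in> brick i j" "D y \<in> brick i' j'"
    using y unfolding c d by (metis UnCI imageE)+
  moreover have "(i, j) \<noteq> (i', j')" using cd(3) c d by auto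
  ultimately obtain p where p: "p \<in> brick i j \<inter> brick i' j'" "p \<in> interior (brick i j \<union> brick i' j')"
    using bricks_meet_along_edge[of i j i' j'] by blast
  have "g ` interior (brick i j \<union> brick i' j') = interior (c \<union> d)"
    using g by (rule homeomorphism_image_interior) simp
  then have "g p \<in> interior (c \<union> d)" using p(2) by blast
  moreover have "g p \<in> c \<inter> d" using p(1) c d by blast
  ultimately show "\<exists>x\<in>c \<inter> d. x \<in> interior (c \<union> d)" by blast
qed

end

section \<open>Rectangular neighbourhoods in a chart\<close>

text \<open>A Lebesgue number argument: finitely many local sheets cover \<open>M\<close>, and the
  smallest of their margins in the target serves all points.\<close>

lemma uniform_sheets:
  fixes d :: "complex \<Rightarrow> real \<times> real"
  assumes cont: "continuous_on UNIV d"
    and loc: "\<And>x. \<exists>U g. open U \<and> x \<in> U \<and> open (d ` U) \<and> homeomorphism U (d ` U) d g"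
    and "compact M" "\<delta> > 0"
  obtains \<epsilon> where "\<epsilon> > 0"
    "\<And>x. x \<in> M \<Longrightarrow> \<exists>U g. open U \<and> x \<in> U \<and> U \<subseteq> ball x \<delta> \<and> homeomorphism U (ball (d x) \<epsilon>) d g"
proof -
  \<comment> \<open>The image contains a ball of radius \<open>2 * e\<close>, so a ball of radius
    \<open>e\<close> still fits around any point within \<open>e\<close> of \<open>d y\<close>.
    Likewise \<open>\<delta>/2\<close> puts \<open>V\<close> inside \<open>ball x \<delta>\<close>
    for every \<open>x\<close> in \<open>V\<close>.\<close>
  have "\<exists>V g e. open V \<and> y \<in> V \<and> V \<subseteq> ball y (\<delta>/2) \<and> homeomorphism V (d ` V) d g
      \<and> e > 0 \<and> ball (d y) (2 * e) \<subseteq> d ` V" for y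
  proof -
    obtain U g where U: "open U" "y \<in> U" "open (d ` U)" "homeomorphism U (d ` U) d g"
      using loc by blast
    define V where "V = U \<inter> ball y (\<delta>/2)"
    have V: "open V" "y \<in> V" "V \<subseteq> U" "V \<subseteq> ball y (\<delta>/2)"
      using U(1,2) \<open>\<delta> > 0\<close> unfolding V_def by auto
    have "openin (top_of_set U) V" using V(1,3) open_subset by blast
    then have "openin (top_of_set (d ` U)) (d ` V)" by (rule homeomorphism_imp_open_map[OF U(4)])
    then have "open (d ` V)" using U(3) openin_open_trans by blast
    then obtain e where e: "e > 0" "ball (d y) e \<subseteq> d ` V" using V(2) by (meson imageI openE)
    have "homeomorphism V (d ` V) d g"
      by (rule homeomorphism_of_subsets[OF U(4) V(3)]) (use V(3) in auto)
    then show ?thesis using V e by (intro exI[of _ V] exI[of _ g] exI[of _ "e/2"]) auto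
  qed
  then obtain V g e where V: "\<And>y. open (V y)" "\<And>y. y \<in> V y" "\<And>y. V y \<subseteq> ball y (\<delta>/2)"
    and g: "\<And>y. homeomorphism (V y) (d ` V y) d (g y)"
    and e: "\<And>y. e y > 0" "\<And>y. ball (d y) (2 * e y) \<subseteq> d ` V y"
    by metis
  define N where "N y = V y \<inter> d -` ball (d y) (e y)" for y
  have "open (N y)" for y
    unfolding N_def using cont V(1) by (intro open_Int open_vimage) auto
  moreover have "M \<subseteq> (\<Union>y\<in>M. N y)" using V(2) e(1) unfolding N_def by auto
  ultimately obtain F where F: "F \<subseteq> M" "finite F" "M \<subseteq> (\<Union>y\<in>F. N y)"
    using compactE_image[OF \<open>compact M\<close>] by metis
  define \<epsilon> where "\<epsilon> = Min (insert 1 (e ` F))"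
  have \<epsilon>: "\<epsilon> > 0" "\<And>y. y \<in> F \<Longrightarrow> \<epsilon> \<le> e y"
    unfolding \<epsilon>_def using F(2) e(1) by auto
  show ?thesis
  proof (rule that[OF \<epsilon>(1)])
    fix x assume "x \<in> M"
    then obtain y where y: "y \<in> F" "x \<in> V y" "d x \<in> ball (d y) (e y)"
      using F(3) unfolding N_def by blast
    have "ball (d x) \<epsilon> \<subseteq> ball (d y) (2 * e y)"
      using y(3) \<epsilon>(2)[OF y(1)] by (simp add: ball_subset_ball_iff dist_commute)
    then have sub: "ball (d x) \<epsilon> \<subseteq> d ` V y" using e(2) by blast
    define U where "U = g y ` ball (d x) \<epsilon>"
    have hom: "homeomorphism U (ball (d x) \<epsilon>) d (g y)"
      unfolding U_def by (rule sheet_homeomorphism[OF g sub])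
    have UV: "U \<subseteq> V y" unfolding U_def using sub homeomorphism_image2[OF g] by blast
    \<comment> \<open>Rewriting the image under the local inverse as a preimage shows that it is
      open.\<close>
    have U: "U = V y \<inter> d -` ball (d x) \<epsilon>"
    proof
      show "U \<subseteq> V y \<inter> d -` ball (d x) \<epsilon>" using UV homeomorphism_image1[OF hom] by blast
      show "V y \<inter> d -` ball (d x) \<epsilon> \<subseteq> U"
        unfolding U_def using homeomorphism_apply1[OF g] by (metis IntE imageI subsetI vimageE)
    qed
    have "open U" unfolding U using cont V(1) by (intro open_Int open_vimage) auto
    moreover have "x \<in> U" unfolding U using y(2) \<epsilon>(1) by simp
    moreover have "U \<subseteq> ball x \<delta>"
    proof
      fix z assume "z \<in> U"
      then have "dist y z < \<delta>/2" "dist y x < \<delta>/2" using UV V(3) y(2) by (auto simp: subset_iff)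
      then show "z \<in> ball x \<delta>" using dist_triangle_half_r by (metis mem_ball)
    qed
    ultimately show "\<exists>U g. open U \<and> x \<in> U \<and> U \<subseteq> ball x \<delta> \<and> homeomorphism U (ball (d x) \<epsilon>) d g"
      using hom by blast
  qed
qed

lemma homeomorphism_scaleR:
  fixes d :: "complex \<Rightarrow> real \<times> real"
  assumes "homeomorphism U B d g" "n \<noteq> 0"
  shows "homeomorphism U ((*\<^sub>R) n ` B) (\<lambda>z. n *\<^sub>R d z) (\<lambda>p. g (inverse n *\<^sub>R p))"
proof -
  have "homeomorphism B ((*\<^sub>R) n ` B) ((*\<^sub>R) n) ((*\<^sub>R) (inverse n))"
    unfolding homeomorphism_def using assms(2) by (auto simp: image_image intro!: continuous_intros)
  from homeomorphism_compose[OF assms(1) this] show ?thesis by (simp add: o_def)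
qed

text \<open>The map is enlarged instead of the bricks being shrunk, so the integral bricks and the
  radius 7 serve at every scale.\<close>

lemma brick_sheets_exist:
  fixes d :: "complex \<Rightarrow> real \<times> real"
  assumes cont: "continuous_on UNIV d"
    and loc: "\<And>x. \<exists>U g. open U \<and> x \<in> U \<and> open (d ` U) \<and> homeomorphism U (d ` U) d g"
    and M: "compact M" "\<delta> > 0"
  obtains n :: nat where "n > 0" "brick_sheets (\<lambda>z. real n *\<^sub>R d z) M \<delta>"
proof -
  obtain \<epsilon> where e: "\<epsilon> > 0" and
    sh: "\<And>x. x \<in> M \<Longrightarrow> \<exists>U g. open U \<and> x \<in> U \<and> U \<subseteq> ball x \<delta> \<and> homeomorphism U (ball (d x) \<epsilon>) d g"
    using uniform_sheets[OF assms] by metis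
  obtain n :: nat where n: "7 / \<epsilon> < real n" using reals_Archimedean2 by blast
  have n0: "real n > 0" using n e by (meson divide_pos_pos less_trans zero_less_numeral)
  have small: "7 / real n \<le> \<epsilon>" using n n0 e by (simp add: field_simps)
  have "brick_sheets (\<lambda>z. real n *\<^sub>R d z) M \<delta>"
  proof
    show "compact M" by fact
    show "continuous_on UNIV (\<lambda>z. real n *\<^sub>R d z)" using cont by (intro continuous_intros)
    fix x assume "x \<in> M"
    then obtain U g where U: "open U" "x \<in> U" "U \<subseteq> ball x \<delta>" "homeomorphism U (ball (d x) \<epsilon>) d g"
      using sh by blast
    let ?B = "ball (d x) (7 / real n)"
    have sub: "?B \<subseteq> ball (d x) \<epsilon>" using small by (simp add: subset_ball)
    have "homeomorphism (g ` ?B) ?B d g" by (rule sheet_homeomorphism[OF U(4) sub])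
    then have "homeomorphism (g ` ?B) ((*\<^sub>R) (real n) ` ?B) (\<lambda>z. real n *\<^sub>R d z) (\<lambda>p. g (inverse (real n) *\<^sub>R p))"
      by (rule homeomorphism_scaleR) (use n0 in simp)
    moreover have "(*\<^sub>R) (real n) ` ?B = ball (real n *\<^sub>R d x) 7"
      using ball_scale[of "real n" "d x" "7 / real n"] n0 by simp
    moreover have "openin (top_of_set U) (g ` ?B)"
      by (rule homeomorphism_imp_open_map[OF homeomorphism_symD[OF U(4)]]) (use sub open_subset in auto)
    then have "open (g ` ?B)" using U(1) openin_open_trans by blast
    moreover have "x \<in> g ` ?B"
      using homeomorphism_apply1[OF U(4,2)] n0 by (metis centre_in_ball divide_pos_pos image_eqI zero_less_numeral)
    moreover have "g ` ?B \<subseteq> U" using sub homeomorphism_image2[OF U(4)] by blast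
    ultimately show "\<exists>U g. open U \<and> x \<in> U \<and> U \<subseteq> ball x \<delta> \<and>
        homeomorphism U (ball (real n *\<^sub>R d x) 7) (\<lambda>z. real n *\<^sub>R d z) g"
      using U(3) by (metis order_trans)
  qed
  then show ?thesis using that n0 by simp
qed

text \<open>Undoing the scaling divides the integral corners of the brick by \<open>n\<close>;
  rationality comes from here.\<close>

lemma cell_scaled_rational_rectangle:
  assumes c: "cell (\<lambda>z. real n *\<^sub>R d z) (brick i j) c" and n: "n > 0"
  obtains a b c' d' g where "a < b" "c' < d'" "a \<in> \<rat>" "b \<in> \<rat>" "c' \<in> \<rat>" "d' \<in> \<rat>"
    "d ` c = {a..b} \<times> {c'..d'}" "homeomorphism c (d ` c) d g"
proof -
  obtain h where h: "homeomorphism c (brick i j) (\<lambda>z. real n *\<^sub>R d z) h" using c unfolding cell_def by blast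
  have n0: "real n > 0" using n by simp
  let ?s = "inverse (real n)"
  from homeomorphism_scaleR[OF h, of ?s]
  have hom: "homeomorphism c ((*\<^sub>R) ?s ` brick i j) d (\<lambda>p. h (real n *\<^sub>R p))"
    using n0 by simp
  have im: "(*\<^sub>R) ?s ` brick i j =
      {of_int (2*i + j) / real n..of_int (2*i + j + 2) / real n} \<times> {of_int j / real n..of_int (j + 1) / real n}"
    (is "_ = ?R")
  proof
    show "(*\<^sub>R) ?s ` brick i j \<subseteq> ?R"
    proof (rule image_subsetI)
      fix p assume p: "p \<in> brick i j"
      obtain x y where xy: "p = (x, y)" by fastforce
      have "?s *\<^sub>R p = (x / real n, y / real n)" unfolding xy by (simp add: divide_inverse_commute)
      then show "?s *\<^sub>R p \<in> ?R"
        using n0 p unfolding xy mem_brick by (auto intro!: divide_right_mono)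
    qed
    show "?R \<subseteq> (*\<^sub>R) ?s ` brick i j"
    proof clarify
      fix x y assume "x \<in> {of_int (2*i + j) / real n..of_int (2*i + j + 2) / real n}"
        "y \<in> {of_int j / real n..of_int (j + 1) / real n}"
      then have "(real n * x, real n * y) \<in> brick i j"
        unfolding mem_brick atLeastAtMost_iff pos_divide_le_eq[OF n0] pos_le_divide_eq[OF n0]
        by (simp add: mult.commute)
      moreover have "(x, y) = ?s *\<^sub>R (real n * x, real n * y)" using n0 by simp
      ultimately show "(x, y) \<in> (*\<^sub>R) ?s ` brick i j" by blast
    qed
  qed
  have dc: "d ` c = ?R" using homeomorphism_image1[OF hom] im by simp
  show ?thesis
  proof (rule that)
    show "real_of_int (2*i + j) / real n < of_int (2*i + j + 2) / real n"
      "real_of_int j / real n < of_int (j + 1) / real n"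
      using n0 by (auto intro!: divide_strict_right_mono)
    show "homeomorphism c (d ` c) d (\<lambda>p. h (real n *\<^sub>R p))"
      using hom homeomorphism_image1[OF hom] by simp
  qed (use dc in auto)
qed

lemma rectangular_neighbourhood_plane:
  fixes d :: "complex \<Rightarrow> real \<times> real"
  assumes cont: "continuous_on UNIV d"
    and loc: "\<And>x. \<exists>U g. open U \<and> x \<in> U \<and> open (d ` U) \<and> homeomorphism U (d ` U) d g"
    and K1: "compact K1" "path_connected K1" "K1 \<noteq> {}"
    and K3: "compact K3" "K1 \<subseteq> interior K3"
  obtains F C where "finite F"
    "\<And>R. R \<in> F \<Longrightarrow> \<exists>a b c' d' g. a < b \<and> c' < d' \<and> a \<in> \<rat> \<and> b \<in> \<rat> \<and> c' \<in> \<rat> \<and> d' \<in> \<rat>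
      \<and> d ` R = {a..b} \<times> {c'..d'} \<and> homeomorphism R (d ` R) d g"
    "path_connected (\<Union>F)" "K1 \<subseteq> interior (\<Union>F)" "\<Union>F \<subseteq> interior K3"
    "\<And>Y. Y \<in> C \<Longrightarrow> Y homeomorphic sphere (0::complex) 1" "pairwise disjnt C" "\<Union>C = frontier (\<Union>F)"
    "closed_disk K3 \<Longrightarrow> closed_disk (\<Union>F)"
proof -
  \<comment> \<open>Cells through \<open>K1\<close> will be smaller than \<open>\<delta>\<close>,
    which keeps them in \<open>interior K3\<close>.\<close>
  obtain \<delta> where \<delta>: "\<delta> > 0" "(\<Union>x\<in>K1. ball x \<delta>) \<subseteq> interior K3"
    using compact_subset_open_imp_ball_epsilon_subset[OF K1(1) open_interior K3(2)] by metis
  \<comment> \<open>A round disk is convex, so a set inside it has its holes inside it too, and the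
    cells over this disk cover them.\<close>
  obtain r where r: "K3 \<subseteq> ball 0 r" using K3(1) compact_imp_bounded bounded_subset_ballD by metis
  obtain n :: nat where n: "n > 0" and sh: "brick_sheets (\<lambda>z. real n *\<^sub>R d z) (cball 0 r) \<delta>"
    by (rule brick_sheets_exist[OF cont loc compact_cball \<delta>(1)])
  interpret brick_sheets "\<lambda>z. real n *\<^sub>R d z" "cball 0 r" \<delta> by (fact sh)
  have "cball 0 r \<subseteq> \<Union>cells" using cell_through_point by blast
  then have "interior (cball 0 r) \<subseteq> interior (\<Union>cells)" by (rule interior_mono)
  then have ball_sub: "ball 0 r \<subseteq> interior (\<Union>cells)" by simp
  have K1r: "K1 \<subseteq> ball 0 r" using K3(2) interior_subset r by blast
  define S where "S = {c \<in> cells. c \<inter> K1 \<noteq> {}}"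
  define K where "K = \<Union>S"
  have S: "S \<subseteq> cells" unfolding S_def by blast
  \<comment> \<open>Cells outside \<open>S\<close> miss \<open>K1\<close> and have a closed union,
    so removing them leaves a neighbourhood of \<open>K1\<close>.\<close>
  have K1K: "K1 \<subseteq> interior K"
  proof
    fix x assume x: "x \<in> K1"
    have "x \<notin> \<Union>(cells - S)" using x unfolding S_def by blast
    moreover have "x \<in> interior (\<Union>cells)" using x K1r ball_sub by blast
    moreover have "open (interior (\<Union>cells) - \<Union>(cells - S))"
      using closed_Union_tiles[of "cells - S"] by (intro open_Diff) auto
    moreover have "interior (\<Union>cells) - \<Union>(cells - S) \<subseteq> K"
      using interior_subset unfolding K_def by blast
    ultimately show "x \<in> interior K" by (meson DiffI interiorI)
  qed
  have KK3: "K \<subseteq> interior K3"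
    unfolding K_def
  proof (rule Union_least)
    fix c assume "c \<in> S"
    then obtain x where x: "c \<in> cells" "x \<in> c" "x \<in> K1" unfolding S_def by blast
    moreover have "x \<in> cball 0 r" using x(3) K1r ball_subset_cball by blast
    ultimately have "c \<subseteq> ball x \<delta>" using cell_subset_ball by blast
    then show "c \<subseteq> interior K3" using \<delta>(2) x(3) by blast
  qed
  have Kr: "K \<subseteq> ball 0 r" using KK3 interior_subset r by blast
  obtain p where p: "p \<in> K1" using K1(3) by blast
  \<comment> \<open>Every chosen cell meets \<open>K1\<close>, so all paths can be routed through
    \<open>K1\<close>.\<close>
  have pcK: "path_connected K"
  proof -
    have "path_component K p y" if y: "y \<in> K" for y
    proof -
      obtain c where c: "c \<in> S" "y \<in> c" using y unfolding K_def by blast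
      have "c \<in> cells" "K1 \<inter> c \<noteq> {}" using c(1) unfolding S_def by auto
      then have "path_connected (K1 \<union> c)"
        using K1(2) closed_disk_path_connected[OF tile_disk] by (intro path_connected_Un) auto
      then have "path_component (K1 \<union> c) p y"
        unfolding path_connected_component using p c(2) by blast
      moreover have "K1 \<union> c \<subseteq> K" using K1K interior_subset c(1) unfolding K_def by blast
      ultimately show ?thesis using path_component_of_subset by metis
    qed
    then show ?thesis
      unfolding path_connected_component using path_component_sym path_component_trans by meson
  qed
  then have connK: "connected K" by (rule path_connected_imp_connected)
  have Sne: "S \<noteq> {}" using p K1K interior_subset unfolding K_def by blast
  have "- ball 0 r \<subseteq> outside K" using Kr by (intro outside_subset_convex) auto
  then have fill_sub: "K \<union> inside K \<subseteq> interior (\<Union>cells)"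
    using Kr ball_sub inside_Int_outside[of K] by blast
  have inK: "inside K \<subseteq> \<Union>cells" using fill_sub interior_subset by blast
  have rect: "\<exists>a b c' d' g. a < b \<and> c' < d' \<and> a \<in> \<rat> \<and> b \<in> \<rat> \<and> c' \<in> \<rat> \<and> d' \<in> \<rat>
      \<and> d ` R = {a..b} \<times> {c'..d'} \<and> homeomorphism R (d ` R) d g" if R: "R \<in> cells" for R
  proof -
    obtain i j where "cell (\<lambda>z. real n *\<^sub>R d z) (brick i j) R" using R unfolding cells_def by blast
    then show ?thesis using cell_scaled_rational_rectangle[OF _ n, of d i j R] by metis
  qed
  have fin: "finite F" if "F \<subseteq> cells" for F using that finite_cells finite_subset by blast
  show ?thesis
  proof (cases "closed_disk K3")
    case False
    obtain C where C: "\<And>Y. Y \<in> C \<Longrightarrow> Y homeomorphic sphere (0::complex) 1" "pairwise disjnt C" "\<Union>C = frontier K"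
      using frontier_Union_tiles_circles[OF S Sne] connK fill_sub unfolding K_def by metis
    show ?thesis
      by (rule that[of S C]) (use S fin rect pcK K1K KK3 C False in \<open>auto simp: K_def\<close>)
  next
    case True
    have Fcells: "fill K \<subseteq> cells" unfolding fill_def by blast
    have UF: "\<Union>(fill K) = K \<union> inside K" using Union_fill[OF S] inK unfolding K_def by blast
    have disk: "closed_disk (\<Union>(fill K))"
      unfolding UF using closed_disk_fill[OF S Sne] connK fill_sub unfolding K_def by blast
    have clK: "closed K" unfolding K_def by (rule closed_Union_tiles[OF S])
    have "connected (- K3)"
      using True K3(1) connected_complement_homeomorphic_convex_compact[of K3 "cball (0::complex) 1"]
      unfolding closed_disk_def by auto
    moreover have "\<not> bounded (- K3)"
      using K3(1) compact_imp_bounded cobounded_imp_unbounded by fastforce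
    moreover have "(K3 - K) \<union> - K3 = - K" using KK3 interior_subset by blast
    ultimately have "inside K \<subseteq> K3 - K" by (rule inside_subset)
    \<comment> \<open>Holes of a closed set are open, which improves containment in
      \<open>K3\<close> to containment in its interior.\<close>
    then have "inside K \<subseteq> interior K3" using open_inside[OF clK] by (intro interior_maximal) auto
    then have UK3: "\<Union>(fill K) \<subseteq> interior K3" unfolding UF using KK3 by blast
    have "K1 \<subseteq> interior (\<Union>(fill K))"
      unfolding UF using K1K interior_mono[of K "K \<union> inside K"] by blast
    moreover have "path_connected (\<Union>(fill K))" using disk by (rule closed_disk_path_connected)
    ultimately show ?thesis
      using that[of "fill K" "{frontier (\<Union>(fill K))}"] fin[OF Fcells] rect Fcells UK3 disk
        closed_disk_frontier(1)[OF disk] by (auto simp: subset_iff)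
  qed
qed

section \<open>Transfer to planar surfaces\<close>

lemma homeomorphic_maps_top_of_set_iff:
  "homeomorphic_maps (top_of_set S) (top_of_set T) f g \<longleftrightarrow> homeomorphism S T f g"
  unfolding homeomorphic_maps_def homeomorphism_def by (auto simp: Pi_iff image_iff) metis+

lemma homeomorphic_space_top_of_set_iff:
  "top_of_set S homeomorphic_space top_of_set T \<longleftrightarrow> S homeomorphic T"
  unfolding homeomorphic_space_def homeomorphic_def homeomorphic_maps_top_of_set_iff ..

text \<open>The chart maps onto all of \<open>complex\<close> rather than onto a disk, so interior
  and frontier in the surface become the usual ones of the plane.\<close>

lemma planar_surface_chart:
  assumes "planar_surface X b dev"
  obtains h k where "homeomorphic_maps X (euclidean :: complex topology) h k"
proof -
  have "ball (0::real \<times> real) 1 homeomorphic (UNIV :: complex set)"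
    using homeomorphic_ball_UNIV[of 1 "0::real \<times> real"] homeomorphic_UNIV_UNIV[where 'a = "real \<times> real" and 'b = complex]
      homeomorphic_trans by fastforce
  then have "X homeomorphic_space top_of_set (UNIV :: complex set)"
    using assms homeomorphic_space_trans homeomorphic_space_top_of_set_iff
    unfolding planar_surface_def by blast
  then show ?thesis using that unfolding homeomorphic_space_def by auto
qed

lemma chart_subtopology:
  assumes "homeomorphic_maps X euclidean h k"
  shows "homeomorphic_maps (subtopology X (k ` S)) (top_of_set S) h k"
proof (rule homeomorphic_maps_subtopologies_alt[OF assms])
  show "h ` (topspace X \<inter> k ` S) \<subseteq> S" "k ` (topspace euclidean \<inter> S) \<subseteq> k ` S"
    using assms unfolding homeomorphic_maps_def by auto
qed

lemma developing_map_local_homeomorphism: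
  assumes hk: "homeomorphic_maps X (euclidean :: complex topology) h k"
    and dev: "local_homeomorphism X dev"
  shows "continuous_on UNIV (dev \<circ> k)"
    and "\<exists>U g. open U \<and> x \<in> U \<and> open ((dev \<circ> k) ` U) \<and> homeomorphism U ((dev \<circ> k) ` U) (dev \<circ> k) g"
proof -
  have "continuous_map euclidean X k" "continuous_map X euclidean dev"
    using hk dev unfolding homeomorphic_maps_def local_homeomorphism_def by auto
  then have "continuous_map euclidean euclidean (dev \<circ> k)" by (rule continuous_map_compose)
  then show "continuous_on UNIV (dev \<circ> k)" by simp
  have kx: "k x \<in> topspace X" using hk unfolding homeomorphic_maps_def continuous_map_def by auto
  then obtain W where W: "openin X W" "k x \<in> W" "open (dev ` W)"
    "homeomorphic_map (subtopology X W) (top_of_set (dev ` W)) dev"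
    using dev unfolding local_homeomorphism_def by blast
  obtain e where e: "homeomorphic_maps (subtopology X W) (top_of_set (dev ` W)) dev e"
    using W(4) homeomorphic_map_maps by blast
  have WX: "W \<subseteq> topspace X" using W(1) openin_subset by blast
  then have kh: "k (h y) = y" if "y \<in> W" for y using hk that unfolding homeomorphic_maps_def by auto
  have hk': "h (k z) = z" for z using hk unfolding homeomorphic_maps_def by auto
  define U where "U = h ` W"
  have kU: "k ` U = W" unfolding U_def image_image using kh by simp
  have "homeomorphic_map X euclidean h" using hk homeomorphic_maps_imp_map by blast
  then have "open_map X euclidean h" by (rule homeomorphic_imp_open_map)
  then have "open U" using W(1) unfolding U_def open_map_def by auto
  moreover have "x \<in> U" unfolding U_def using W(2) hk'[of x] by (metis imageI)
  moreover have im: "(dev \<circ> k) ` U = dev ` W" by (subst kU[symmetric]) (simp only: image_comp)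
  have "homeomorphic_maps (top_of_set U) (subtopology X W) k h"
    using chart_subtopology[OF hk, of U] unfolding kU by (rule iffD1[OF homeomorphic_maps_sym])
  then have "homeomorphic_maps (top_of_set U) (top_of_set (dev ` W)) (dev \<circ> k) (h \<circ> e)"
    using e by (intro homeomorphic_maps_compose) auto
  ultimately show "\<exists>U g. open U \<and> x \<in> U \<and> open ((dev \<circ> k) ` U) \<and> homeomorphism U ((dev \<circ> k) ` U) (dev \<circ> k) g"
    using W(3) unfolding homeomorphic_maps_top_of_set_iff im[symmetric] by blast
qed

lemma chart_image_homeomorphic:
  assumes "homeomorphic_maps X (euclidean :: complex topology) h k" "S homeomorphic T"
  shows "subtopology X (k ` S) homeomorphic_space top_of_set T"
proof -
  have "subtopology X (k ` S) homeomorphic_space top_of_set S"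
    using chart_subtopology[OF assms(1)] unfolding homeomorphic_space_def by blast
  then show ?thesis
    using assms(2) homeomorphic_space_trans unfolding homeomorphic_space_top_of_set_iff[symmetric] by blast
qed

lemma chart_image_rectangle:
  assumes hk: "homeomorphic_maps X (euclidean :: complex topology) h k"
    and R: "homeomorphism R ((dev \<circ> k) ` R) (dev \<circ> k) g" "(dev \<circ> k) ` R = {a..b} \<times> {c..d}"
    and lt: "a < b" "c < d"
  shows "closed_rectangle_in X dev (k ` R)" "dev ` k ` R = {a..b} \<times> {c..d}"
proof -
  show im: "dev ` k ` R = {a..b} \<times> {c..d}" using R(2) by (simp add: image_comp)
  have "k ` R \<subseteq> topspace X" using hk unfolding homeomorphic_maps_def continuous_map_def by auto
  moreover have "homeomorphic_map (subtopology X (k ` R)) (top_of_set (dev ` k ` R)) dev"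
  \<comment> \<open>\<open>dev\<close> agrees with \<open>(dev \<circ> k) \<circ> h\<close> only on
    the underlying set of \<open>X\<close>, so the homeomorphism is obtained for the composite and
    then transferred.\<close>
  proof (rule homeomorphic_map_eq)
    have "homeomorphic_maps (top_of_set R) (top_of_set (dev ` k ` R)) (dev \<circ> k) g"
      unfolding homeomorphic_maps_top_of_set_iff using R(1) by (simp add: image_comp)
    then have "homeomorphic_maps (subtopology X (k ` R)) (top_of_set (dev ` k ` R)) ((dev \<circ> k) \<circ> h) (k \<circ> g)"
      using chart_subtopology[OF hk, of R] by (intro homeomorphic_maps_compose) auto
    then show "homeomorphic_map (subtopology X (k ` R)) (top_of_set (dev ` k ` R)) ((dev \<circ> k) \<circ> h)"
      by (rule homeomorphic_maps_imp_map)
    show "((dev \<circ> k) \<circ> h) x = dev x" if "x \<in> topspace (subtopology X (k ` R))" for x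
      using that hk unfolding homeomorphic_maps_def by auto
  qed
  ultimately show "closed_rectangle_in X dev (k ` R)"
    unfolding closed_rectangle_in_def using im lt by blast
qed

theorem mainTheorem19:
  fixes X :: "'a topology" and b :: 'a and dev :: "'a \<Rightarrow> real \<times> real"
    and K1 K3 :: "'a set"
  assumes "planar_surface X b dev"
    and "K1 \<in> PC X b" and "K3 \<in> PC X b"
    and "compactin X K1" and "compactin X K3"
    and "K1 \<subseteq> X interior_of K3"
  shows "\<exists>K2. K2 \<in> PC X b \<and> rational_closed_rect_union X dev K2 \<and>
              K1 \<subseteq> X interior_of K2 \<and> K2 \<subseteq> X interior_of K3 \<and>
              (K3 \<in> closed_Disk X b \<longrightarrow> K2 \<in> closed_Disk X b)"
proof -
  obtain h k where hk: "homeomorphic_maps X (euclidean :: complex topology) h k"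
    using planar_surface_chart[OF assms(1)] .
  have hmap: "homeomorphic_map X euclidean h" and kmap: "homeomorphic_map euclidean X k"
    using hk homeomorphic_maps_map by blast+
  have hcont: "continuous_map X euclidean h" and kcont: "continuous_map euclidean X k"
    using hk unfolding homeomorphic_maps_def by auto
  have kh: "k (h y) = y" if "y \<in> topspace X" for y using hk that unfolding homeomorphic_maps_def by auto
  have khS: "k ` h ` S = S" if "S \<subseteq> topspace X" for S
    unfolding image_image using kh that by (auto simp: subset_iff image_iff)
  have loc: "local_homeomorphism X dev" using assms(1) unfolding planar_surface_def by blast
  have K: "K1 \<subseteq> topspace X" "K3 \<subseteq> topspace X" "path_connectedin X K1" "b \<in> K1"
    using assms(2,3) unfolding PC_def by auto
  have int3: "interior (h ` K3) = h ` (X interior_of K3)"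
    using homeomorphic_map_interior_of[OF hmap K(2)] by simp
  have kint: "X interior_of (k ` S) = k ` interior S" for S
    using homeomorphic_map_interior_of[OF kmap, of S] by simp
  obtain F C where F: "finite F"
    and rect: "\<And>R. R \<in> F \<Longrightarrow> \<exists>a b c' d' g. a < b \<and> c' < d' \<and> a \<in> \<rat> \<and> b \<in> \<rat> \<and> c' \<in> \<rat> \<and> d' \<in> \<rat>
      \<and> (dev \<circ> k) ` R = {a..b} \<times> {c'..d'} \<and> homeomorphism R ((dev \<circ> k) ` R) (dev \<circ> k) g"
    and pc: "path_connected (\<Union>F)" and K1F: "h ` K1 \<subseteq> interior (\<Union>F)" and FK3: "\<Union>F \<subseteq> interior (h ` K3)"
    and C: "\<And>Y. Y \<in> C \<Longrightarrow> Y homeomorphic sphere (0::complex) 1" "pairwise disjnt C" "\<Union>C = frontier (\<Union>F)"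
    and disk: "closed_disk (h ` K3) \<Longrightarrow> closed_disk (\<Union>F)"
  proof (rule rectangular_neighbourhood_plane[OF developing_map_local_homeomorphism[OF hk loc], of "h ` K1" "h ` K3"])
    show "compact (h ` K1)" "compact (h ` K3)"
      using image_compactin[OF _ hcont] assms(4,5) by auto
    show "path_connected (h ` K1)"
      using path_connectedin_continuous_map_image[OF hcont K(3)] by simp
    show "h ` K1 \<noteq> {}" using K(4) by blast
    show "h ` K1 \<subseteq> interior (h ` K3)" unfolding int3 using assms(6) by blast
  qed blast
  define K2 where "K2 = k ` \<Union>F"
  have K2X: "K2 \<subseteq> topspace X" using kcont unfolding K2_def continuous_map_def by auto
  have K1K2: "K1 \<subseteq> X interior_of K2"
  proof -
    have "k ` h ` K1 \<subseteq> k ` interior (\<Union>F)" using K1F by (rule image_mono)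
    then show ?thesis unfolding khS[OF K(1)] K2_def kint .
  qed
  \<comment> \<open>The basepoint lies in \<open>K1\<close>, hence in the interior of
    \<open>K2\<close>; \<open>PC\<close> asks for the weaker fact and \<open>closed_Disk\<close> for
    the stronger one.\<close>
  have bK2: "b \<in> X interior_of K2" "b \<in> K2" using K1K2 K(4) interior_of_subset[of X K2] by blast+
  have K2K3: "K2 \<subseteq> X interior_of K3"
  proof -
    have "K2 \<subseteq> k ` h ` (X interior_of K3)" unfolding K2_def int3[symmetric] using FK3 by (rule image_mono)
    then show ?thesis
      using khS[of "X interior_of K3"] interior_of_subset_topspace[of X K3] by simp
  qed
  have pcK2: "path_connectedin X K2"
    unfolding K2_def using path_connectedin_continuous_map_image[OF kcont] pc by simp
  have PC2: "K2 \<in> PC X b" using K2X pcK2 bK2(2) unfolding PC_def by blast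
  let ?F = "(`) k ` F"
  have UF: "\<Union>?F = K2" unfolding K2_def by blast
  have ratF: "rational_closed_rectangle_in X dev R" if R: "R \<in> ?F" for R
  proof -
    obtain Q where Q: "Q \<in> F" "R = k ` Q" using R by blast
    obtain a b c' d' g where q: "a < b" "c' < d'" "a \<in> \<rat>" "b \<in> \<rat>" "c' \<in> \<rat>" "d' \<in> \<rat>"
      "(dev \<circ> k) ` Q = {a..b} \<times> {c'..d'}" "homeomorphism Q ((dev \<circ> k) ` Q) (dev \<circ> k) g"
      using rect[OF Q(1)] by blast
    show ?thesis
      unfolding rational_closed_rectangle_in_def Q(2)
      using chart_image_rectangle[OF hk q(8,7,1,2)] q(3-6) by blast
  qed
  have circles: "\<exists>C. (\<forall>Y\<in>C. subtopology X Y homeomorphic_space top_of_set (sphere (0::real \<times> real) 1)) \<and>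
          pairwise disjnt C \<and> \<Union>C = X frontier_of K2"
  proof (intro exI conjI ballI)
    fix Y assume "Y \<in> (`) k ` C"
    then obtain Z where Z: "Z \<in> C" "Y = k ` Z" by blast
    have "sphere (0::complex) 1 homeomorphic sphere (0::real \<times> real) 1"
      by (rule homeomorphic_spheres_gen) auto
    then show "subtopology X Y homeomorphic_space top_of_set (sphere (0::real \<times> real) 1)"
      unfolding Z(2) using chart_image_homeomorphic[OF hk] homeomorphic_trans[OF C(1)[OF Z(1)]] by blast
  next
    have "inj k" by (metis hk homeomorphic_maps_def UNIV_I inj_onI topspace_euclidean)
    show "pairwise disjnt ((`) k ` C)"
    proof (rule pairwiseI)
      fix Y Y' assume "Y \<in> (`) k ` C" "Y' \<in> (`) k ` C" "Y \<noteq> Y'"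
      then obtain Z Z' where Z: "Z \<in> C" "Z' \<in> C" "Z \<noteq> Z'" "Y = k ` Z" "Y' = k ` Z'" by blast
      then have "Z \<inter> Z' = {}" using C(2) unfolding pairwise_def disjnt_def by blast
      then show "disjnt Y Y'"
        unfolding disjnt_def Z(4,5) image_Int[OF \<open>inj k\<close>, symmetric] by simp
    qed
    have "X frontier_of K2 = k ` frontier (\<Union>F)"
      using homeomorphic_map_frontier_of[OF kmap, of "\<Union>F"] unfolding K2_def by simp
    then show "\<Union>((`) k ` C) = X frontier_of K2" unfolding C(3)[symmetric] by blast
  qed
  have union: "rational_closed_rect_union X dev K2"
    unfolding rational_closed_rect_union_def closed_rect_union_def
  proof (intro conjI circles)
    show rat: "\<exists>F. finite F \<and> (\<forall>R\<in>F. rational_closed_rectangle_in X dev R) \<and> \<Union>F = K2"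
      using F ratF UF by (intro exI[of _ ?F]) auto
    then show "\<exists>F. finite F \<and> (\<forall>R\<in>F. closed_rectangle_in X dev R) \<and> \<Union>F = K2"
      unfolding rational_closed_rectangle_in_def by blast
    show "connectedin X K2" using pcK2 by (rule path_connectedin_imp_connectedin)
  qed
  have "K2 \<in> closed_Disk X b" if K3: "K3 \<in> closed_Disk X b"
  proof -
    have balls: "cball (0::complex) 1 homeomorphic cball (0::real \<times> real) 1"
      by (rule homeomorphic_convex_compact_sets) (simp_all add: aff_dim_nonempty_interior)
    have "subtopology X K3 homeomorphic_space top_of_set (cball (0::real \<times> real) 1)"
      using K3 unfolding closed_Disk_def by blast
    moreover have "subtopology X K3 homeomorphic_space top_of_set (h ` K3)"
      using chart_image_homeomorphic[OF hk homeomorphic_refl, of "h ` K3"] khS[OF K(2)] by simp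
    ultimately have "h ` K3 homeomorphic cball (0::real \<times> real) 1"
      using homeomorphic_space_trans homeomorphic_space_sym homeomorphic_space_top_of_set_iff by metis
    then have "closed_disk (h ` K3)"
      unfolding closed_disk_def using balls homeomorphic_trans homeomorphic_sym by metis
    then have "\<Union>F homeomorphic cball (0::real \<times> real) 1"
      using disk balls homeomorphic_trans unfolding closed_disk_def by metis
    then have "subtopology X K2 homeomorphic_space top_of_set (cball (0::real \<times> real) 1)"
      unfolding K2_def by (rule chart_image_homeomorphic[OF hk])
    then show ?thesis using PC2 bK2(1) unfolding closed_Disk_def by blast
  qed
  then show ?thesis using PC2 union K1K2 K2K3 by blast
qed

end
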